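(* Let $\Omega$ be an infinite set and let $\mathfrak{P}(\Omega)$ denote its powerset. Then: (1) $\coprod^0_{\mathfrak{P}(\Omega)}\operatorname{Eq}\Omega$ has a $0$-lattice embedding into $\operatorname{Eq}\Omega$; (2) $\coprod_{\mathfrak{P}(\Omega)}\operatorname{Eq}\Omega$ has a lattice embedding into $\operatorname{Eq}\Omega$; (3) $\coprod^1_{\mathfrak{P}(\Omega)}(\operatorname{Eq}\Omega)^{\mathrm{op}}$ has a $1$-lattice embedding into $(\operatorname{Eq}\Omega)^{\mathrm{op}}$; (4) $\coprod_{\mathfrak{P}(\Omega)}(\operatorname{Eq}\Omega)^{\mathrm{op}}$ has a lattice embedding into $(\operatorname{Eq}\Omega)^{\mathrm{op}}$.
   Context: $\operatorname{Eq}\Omega$ denotes the lattice of all equivalence relations on $\Omega$, ordered by inclusion; $L^{\mathrm{op}}$ is the dual of a lattice $L$. For a set $I$ and a lattice $L$: $\coprod_I L$ is the coproduct (free product) of $I$ copies of $L$ in the variety of all lattices; if $L$ has a zero, $\coprod^0_I L$ is the coproduct of $I$ copies of $L$ in the category of lattices with zero and zero-preserving homomorphisms; if $L$ has a unit, $\coprod^1_I L$ is the coproduct in the category of lattices with unit and unit-preserving homomorphisms. A $0$-lattice embedding (resp. $1$-lattice embedding) is a one-to-one lattice homomorphism preserving the least (resp. greatest) element. *)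

theory Defs
  imports Main
begin

definition EqL :: "'a set \<Rightarrow> ('a \<times> 'a) set set" where
  "EqL \<Omega> = {R. equiv \<Omega> R}"

definition eq_meet :: "('a \<times> 'a) set \<Rightarrow> ('a \<times> 'a) set \<Rightarrow> ('a \<times> 'a) set" where
  "eq_meet R S = R \<inter> S"

definition eq_join :: "('a \<times> 'a) set \<Rightarrow> ('a \<times> 'a) set \<Rightarrow> ('a \<times> 'a) set" where
  "eq_join R S = trancl (R \<union> S)"

text \<open>A lattice is given by carrier A, meet mt, join jn.  Generators of the coproduct of
  I copies of it are pairs (i, x), i in I, x in A.\<close>

datatype ('i, 'b) lterm = Gen 'i 'b | TJoin "('i, 'b) lterm" "('i, 'b) lterm"
  | TMeet "('i, 'b) lterm" "('i, 'b) lterm"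

fun wf_term :: "'i set \<Rightarrow> 'b set \<Rightarrow> ('i, 'b) lterm \<Rightarrow> bool" where
  "wf_term I A (Gen i x) = (i \<in> I \<and> x \<in> A)"
| "wf_term I A (TJoin p q) = (wf_term I A p \<and> wf_term I A q)"
| "wf_term I A (TMeet p q) = (wf_term I A p \<and> wf_term I A q)"

text \<open>cop_rel I A mt jn Z: the least congruence on well-formed terms making the quotient a
  lattice, making each injection x \<mapsto> [Gen i x] a lattice homomorphism, and identifying
  Gen i z with Gen j z for all z in Z (Z = {} : coproduct in all lattices;
  Z = {0}: coproduct in lattices with zero; Z = {1}: coproduct in lattices with unit).\<close>

inductive cop_rel :: "'i set \<Rightarrow> 'b set \<Rightarrow> ('b \<Rightarrow> 'b \<Rightarrow> 'b) \<Rightarrow> ('b \<Rightarrow> 'b \<Rightarrow> 'b) \<Rightarrow> 'b set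
    \<Rightarrow> ('i, 'b) lterm \<Rightarrow> ('i, 'b) lterm \<Rightarrow> bool"
  for I A mt jn Z where
  crefl: "wf_term I A p \<Longrightarrow> cop_rel I A mt jn Z p p"
| csym: "cop_rel I A mt jn Z p q \<Longrightarrow> cop_rel I A mt jn Z q p"
| ctrans: "cop_rel I A mt jn Z p q \<Longrightarrow> cop_rel I A mt jn Z q r \<Longrightarrow> cop_rel I A mt jn Z p r"
| cjoin: "cop_rel I A mt jn Z p p' \<Longrightarrow> cop_rel I A mt jn Z q q' \<Longrightarrow>
     cop_rel I A mt jn Z (TJoin p q) (TJoin p' q')"
| cmeet: "cop_rel I A mt jn Z p p' \<Longrightarrow> cop_rel I A mt jn Z q q' \<Longrightarrow>
     cop_rel I A mt jn Z (TMeet p q) (TMeet p' q')"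
| join_comm: "wf_term I A p \<Longrightarrow> wf_term I A q \<Longrightarrow> cop_rel I A mt jn Z (TJoin p q) (TJoin q p)"
| meet_comm: "wf_term I A p \<Longrightarrow> wf_term I A q \<Longrightarrow> cop_rel I A mt jn Z (TMeet p q) (TMeet q p)"
| join_assoc: "wf_term I A p \<Longrightarrow> wf_term I A q \<Longrightarrow> wf_term I A r \<Longrightarrow>
     cop_rel I A mt jn Z (TJoin (TJoin p q) r) (TJoin p (TJoin q r))"
| meet_assoc: "wf_term I A p \<Longrightarrow> wf_term I A q \<Longrightarrow> wf_term I A r \<Longrightarrow>
     cop_rel I A mt jn Z (TMeet (TMeet p q) r) (TMeet p (TMeet q r))"
| join_absorb: "wf_term I A p \<Longrightarrow> wf_term I A q \<Longrightarrow> cop_rel I A mt jn Z (TJoin p (TMeet p q)) p"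
| meet_absorb: "wf_term I A p \<Longrightarrow> wf_term I A q \<Longrightarrow> cop_rel I A mt jn Z (TMeet p (TJoin p q)) p"
| gen_join: "i \<in> I \<Longrightarrow> x \<in> A \<Longrightarrow> y \<in> A \<Longrightarrow>
     cop_rel I A mt jn Z (Gen i (jn x y)) (TJoin (Gen i x) (Gen i y))"
| gen_meet: "i \<in> I \<Longrightarrow> x \<in> A \<Longrightarrow> y \<in> A \<Longrightarrow>
     cop_rel I A mt jn Z (Gen i (mt x y)) (TMeet (Gen i x) (Gen i y))"
| gen_ident: "i \<in> I \<Longrightarrow> j \<in> I \<Longrightarrow> z \<in> Z \<Longrightarrow> z \<in> A \<Longrightarrow>
     cop_rel I A mt jn Z (Gen i z) (Gen j z)"

definition cop_class :: "'i set \<Rightarrow> 'b set \<Rightarrow> ('b \<Rightarrow> 'b \<Rightarrow> 'b) \<Rightarrow> ('b \<Rightarrow> 'b \<Rightarrow> 'b) \<Rightarrow> 'b set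
    \<Rightarrow> ('i, 'b) lterm \<Rightarrow> ('i, 'b) lterm set" where
  "cop_class I A mt jn Z p = {q. cop_rel I A mt jn Z p q}"

definition cop_carrier :: "'i set \<Rightarrow> 'b set \<Rightarrow> ('b \<Rightarrow> 'b \<Rightarrow> 'b) \<Rightarrow> ('b \<Rightarrow> 'b \<Rightarrow> 'b) \<Rightarrow> 'b set
    \<Rightarrow> ('i, 'b) lterm set set" where
  "cop_carrier I A mt jn Z = cop_class I A mt jn Z ` {p. wf_term I A p}"

definition cop_embedding ::
  "'i set \<Rightarrow> 'b set \<Rightarrow> ('b \<Rightarrow> 'b \<Rightarrow> 'b) \<Rightarrow> ('b \<Rightarrow> 'b \<Rightarrow> 'b) \<Rightarrow> 'b set
   \<Rightarrow> 'c set \<Rightarrow> ('c \<Rightarrow> 'c \<Rightarrow> 'c) \<Rightarrow> ('c \<Rightarrow> 'c \<Rightarrow> 'c)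
   \<Rightarrow> (('i, 'b) lterm set \<Rightarrow> 'c) \<Rightarrow> bool" where
  "cop_embedding I A mt jn Z B mtB jnB h \<longleftrightarrow>
     inj_on h (cop_carrier I A mt jn Z) \<and>
     h ` cop_carrier I A mt jn Z \<subseteq> B \<and>
     (\<forall>p q. wf_term I A p \<longrightarrow> wf_term I A q \<longrightarrow>
        h (cop_class I A mt jn Z (TJoin p q)) =
          jnB (h (cop_class I A mt jn Z p)) (h (cop_class I A mt jn Z q)) \<and>
        h (cop_class I A mt jn Z (TMeet p q)) =
          mtB (h (cop_class I A mt jn Z p)) (h (cop_class I A mt jn Z q)))"

end

(*
The order of a free product of lattices with amalgamated zero is decided by the Graetzer-Lakser
recursion: p <= q holds either structurally or because, for some index i, the upper i-cover of p
lies below the lower i-cover of q.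

Eq Omega is algebraic, and its compact elements form a sublattice K with card K <= card Omega.
Every term over Eq Omega is determined by the set of K-terms below it, because upper covers are
approximated by K-terms, and K-terms are compact with respect to joins of terms.  The lattice of
K-terms acts on a set of points obtained by freely adjoining chains x - M0 - M1 - M2 - y labelled
a, b, a, b whenever the distance of x and y is at most a \<or> b (Whitman, Jonsson); letting a term act
by the union of the actions of the K-terms below it represents the whole free product faithfully.

To reach an index set of size 2^card Omega, intersect the indices with all finite F \<subseteq> Omega (de Bruijn):
finitely many subsets of Omega are separated by some F, and the disjoint union over all F of the
representations still has only card Omega points.

The case without amalgamated zero follows by adjoining a new zero to Eq Omega, and the two dual
statements by exchanging joins and meets in terms.
*)

theory Submission
  imports Defs "HOL-Library.Option_ord" "HOL-Library.Lattice_Constructions" "HOL-Library.Equipollence"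
begin

section \<open>The order on terms\<close>

text \<open>Representing a lattice by labelled chains needs about as many points as there are
  labels, and the coproduct is too large for \<Omega> on two counts: the factor and the index set
  each have 2^card \<Omega> elements. Cutting down to compact labels and to finitely many indices is
  allowed only if an inequality that fails for terms still fails after the cut. For labels the
  difficulty is a meet p: it must have enough K-terms below it to refute every failing inequality p
  <= q. Whitman's condition leaves only a few possible reasons for p <= q when p is a meet and q is
  a join or a generator; each is refuted by a K-term, and one K-term combines all refutations. The
  reason through covers has to be refuted at all indices simultaneously, which is why a single term
  approximates the upper covers for all of them. The relation of the zero term is not the identity
  on points. It is divided out when the points are coded in \<Omega>, and this is what makes the
  embedding preserve zero.\<close>

fun lower :: "'i \<Rightarrow> ('i, 'l::bounded_lattice_bot) lterm \<Rightarrow> 'l" where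
  "lower i (Gen j x) = (if i = j then x else bot)"
| "lower i (TJoin p q) = sup (lower i p) (lower i q)"
| "lower i (TMeet p q) = inf (lower i p) (lower i q)"

text \<open>The value \<^term>\<open>top.Top\<close> means that no element of factor i lies above the term.  As the zeros of
  the factors are identified, a meet that vanishes in one factor vanishes in all of them.\<close>

fun upper :: "'i set \<Rightarrow> 'i \<Rightarrow> ('i, 'l::bounded_lattice_bot) lterm \<Rightarrow> 'l top" where
  "upper J i (Gen j x) = (if i = j \<or> x = bot then top.Value x else top.Top)"
| "upper J i (TJoin p q) = sup (upper J i p) (upper J i q)"
| "upper J i (TMeet p q) =
     (if \<exists>j\<in>J. inf (upper J j p) (upper J j q) = top.Value bot then top.Value bot
      else inf (upper J i p) (upper J i q))"

text \<open>Transitivity is not among the rules, so a derivation can be inverted according to the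
  outermost symbols of its two sides; this is the source of Whitman's condition. Elements of the
  factors are compared only in \<open>cover\<close>.\<close>

inductive term_le :: "'i set \<Rightarrow> ('i, 'l::bounded_lattice_bot) lterm \<Rightarrow> ('i, 'l) lterm \<Rightarrow> bool"
  for J where
  cover: "i \<in> J \<Longrightarrow> upper J i p \<le> top.Value (lower i q) \<Longrightarrow> term_le J p q"
| joinL: "term_le J p r \<Longrightarrow> term_le J q r \<Longrightarrow> term_le J (TJoin p q) r"
| meetR: "term_le J p q \<Longrightarrow> term_le J p r \<Longrightarrow> term_le J p (TMeet q r)"
| meetL1: "term_le J p r \<Longrightarrow> term_le J (TMeet p q) r"
| meetL2: "term_le J q r \<Longrightarrow> term_le J (TMeet p q) r"
| joinR1: "term_le J p q \<Longrightarrow> term_le J p (TJoin q r)"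
| joinR2: "term_le J p r \<Longrightarrow> term_le J p (TJoin q r)"

abbreviation wft :: "'i set \<Rightarrow> ('i, 'l) lterm \<Rightarrow> bool" where
  "wft J \<equiv> wf_term J UNIV"

lemma wf_term_mono: "wf_term I A p \<Longrightarrow> I \<subseteq> I' \<Longrightarrow> A \<subseteq> A' \<Longrightarrow> wf_term I' A' p"
  by (induction p) auto

lemma wf_term_wft: "wf_term J A p \<Longrightarrow> wft J p"
  by (erule wf_term_mono) auto

lemma Value_bot_le [simp]: "top.Value (bot :: 'l::bounded_lattice_bot) \<le> x"
  by (cases x) auto

lemma le_Value_bot_iff [simp]: "x \<le> top.Value (bot :: 'l::bounded_lattice_bot) \<longleftrightarrow> x = top.Value bot"
  by (cases x) (auto simp: bot_unique)

lemma sup_Value_bot_iff [simp]: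
  "sup x y = top.Value (bot :: 'l::bounded_lattice_bot) \<longleftrightarrow> x = top.Value bot \<and> y = top.Value bot"
  by (cases x; cases y) (auto simp: sup_top_def)

lemma sup_Top_iff: "sup x y = top.Top \<longleftrightarrow> x = top.Top \<or> y = top.Top"
  by (cases x; cases y) (auto simp: sup_top_def)

lemma inf_Top_iff: "inf x y = top.Top \<longleftrightarrow> x = top.Top \<and> y = top.Top"
  by (cases x; cases y) (auto simp: inf_top_def)

lemma upper_bot_all:
  assumes "i \<in> J" "j \<in> J" "wft J p" "upper J i p = top.Value bot"
  shows "upper J j p = top.Value bot"
  using assms by (induction p) (auto split: if_splits)

text \<open>The second half says that distinct factors meet only in zero: an element of factor j
  below p would otherwise lie below an element of factor i. Both halves go through one induction,
  because for a meet that vanishes in a foreign factor k the lower j-cover is zero by the second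
  half.\<close>

lemma lower_upper:
  assumes "wft J p" "j \<in> J"
  shows "top.Value (lower j p) \<le> upper J j p \<and> (\<forall>i\<in>J. i \<noteq> j \<longrightarrow> upper J i p \<noteq> top.Top \<longrightarrow> lower j p = bot)"
  using assms(1)
proof (induction p)
  case (Gen k x)
  then show ?case by auto
next
  case (TJoin p q)
  have "top.Value (sup (lower j p) (lower j q)) = sup (top.Value (lower j p)) (top.Value (lower j q))"
    by (simp add: sup_top_def)
  also have "\<dots> \<le> sup (upper J j p) (upper J j q)"
    using TJoin by (intro sup_mono) auto
  finally show ?case using TJoin by (auto simp: sup_Top_iff)
next
  case (TMeet p q)
  have zero: "lower j (TMeet p q) = bot" if k: "k \<in> J" and e: "inf (upper J k p) (upper J k q) = top.Value bot" for k
  proof (cases "k = j")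
    case True
    have "top.Value (inf (lower j p) (lower j q)) = inf (top.Value (lower j p)) (top.Value (lower j q))"
      by (simp add: inf_top_def)
    also have "\<dots> \<le> inf (upper J j p) (upper J j q)"
      using TMeet by (intro inf_mono) auto
    finally show ?thesis using e True by (metis le_Value_bot_iff lower.simps(3) top.inject)
  next
    case False
    then have "upper J k p \<noteq> top.Top \<or> upper J k q \<noteq> top.Top" using e by (auto simp: inf_top_def)
    then show ?thesis using TMeet False k by auto
  qed
  have "top.Value (inf (lower j p) (lower j q)) = inf (top.Value (lower j p)) (top.Value (lower j q))"
    by (simp add: inf_top_def)
  also have "\<dots> \<le> inf (upper J j p) (upper J j q)"
    using TMeet by (intro inf_mono) auto
  finally have "top.Value (inf (lower j p) (lower j q)) \<le> inf (upper J j p) (upper J j q)" .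
  then show ?case using zero TMeet by (auto simp: inf_Top_iff)
qed

lemma term_le_mono:
  assumes "term_le J p q" "wft J p" "wft J q" "j \<in> J"
  shows "lower j p \<le> lower j q \<and> upper J j p \<le> upper J j q"
  using assms
proof (induction arbitrary: j rule: term_le.induct)
  case (cover i p q)
  have lq: "top.Value (lower j q) \<le> upper J j q" using lower_upper[of J q j] cover by auto
  show ?case
  proof (cases "i = j")
    case True
    have "top.Value (lower j p) \<le> upper J j p" using lower_upper[of J p j] cover by auto
    also have "\<dots> \<le> top.Value (lower j q)" using cover True by auto
    finally show ?thesis using cover True lq by (auto intro: order_trans)
  next
    \<comment> \<open>As p is bounded in factor i, its lower j-cover is zero. Either the lower
      i-cover of q is zero, and then p vanishes in every factor, or it is not, and then q has no
      bound in factor j.\<close>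
    case False
    have "upper J i p \<noteq> top.Top" using cover by (auto simp: less_eq_top_def)
    then have p: "lower j p = bot" using lower_upper[of J p j] cover False by auto
    show ?thesis
    proof (cases "lower i q = bot")
      case True
      then have "upper J i p = top.Value bot" using cover by auto
      then show ?thesis using upper_bot_all[of i J j p] cover p by auto
    next
      case False
      then have "upper J j q = top.Top" using lower_upper[of J q i] cover \<open>i \<noteq> j\<close> by auto
      then show ?thesis using p by auto
    qed
  qed
next
  case (meetR p q r)
  have "upper J k p = top.Value bot" if "k \<in> J" "inf (upper J k q) (upper J k r) = top.Value bot" for k
  proof -
    have "upper J k p \<le> inf (upper J k q) (upper J k r)" using meetR that(1) by auto
    then show ?thesis using that(2) by (metis le_Value_bot_iff)
  qed
  then have "\<exists>k\<in>J. inf (upper J k q) (upper J k r) = top.Value bot \<Longrightarrow> upper J j p = top.Value bot"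
    using upper_bot_all[of _ J j p] meetR.prems by auto
  then show ?case using meetR by auto
qed (auto intro: le_infI1 le_infI2 le_supI1 le_supI2)

lemma term_le_refl: "wft J p \<Longrightarrow> term_le J p p"
proof (induction p)
  case (Gen i x)
  then show ?case by (auto intro!: cover[of i])
qed (auto intro: term_le.intros)

text \<open>Cut elimination. When the first derivation ends with a rule for the outermost symbol of
  the middle term, the second derivation is analysed in turn; a \<open>cover\<close> step on either
  side absorbs the other derivation because covers are monotone.\<close>

lemma term_le_trans:
  assumes "term_le J p q" "term_le J q r" "wft J p" "wft J q" "wft J r"
  shows "term_le J p r"
  using assms
proof (induction arbitrary: r rule: term_le.induct)
  case (cover i p q)
  have "top.Value (lower i q) \<le> top.Value (lower i r)" using term_le_mono[of J q r i] cover by auto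
  then show ?case using cover term_le.cover[of i J p r] by (blast intro: order_trans)
next
  case (meetR p q1 q2)
  from meetR.prems show ?case
  proof (induction "TMeet q1 q2" r rule: term_le.induct)
    case (cover i r)
    have "term_le J p (TMeet q1 q2)" using meetR by (auto intro: term_le.meetR)
    then have "upper J i p \<le> upper J i (TMeet q1 q2)"
      using term_le_mono[of J p "TMeet q1 q2" i] cover by auto
    then show ?case using cover term_le.cover[of i J p r] by (blast intro: order_trans)
  next
    case (meetR q r)
    then show ?case by (auto intro: term_le.meetR)
  next
    case (meetL1 r)
    then show ?case using meetR.IH by auto
  next
    case (meetL2 r)
    then show ?case using meetR.IH by auto
  qed (auto intro: term_le.intros)
next
  case (joinR1 p q1 q2)
  from joinR1.prems show ?case
  proof (induction "TJoin q1 q2" r rule: term_le.induct)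
    case (cover i r)
    have "term_le J p (TJoin q1 q2)" using joinR1 by (auto intro: term_le.joinR1)
    then have "upper J i p \<le> upper J i (TJoin q1 q2)"
      using term_le_mono[of J p "TJoin q1 q2" i] cover by auto
    then show ?case using cover term_le.cover[of i J p r] by (blast intro: order_trans)
  next
    case (joinL r)
    then show ?case using joinR1.IH by auto
  qed (auto intro: term_le.intros)
next
  case (joinR2 p q2 q1)
  from joinR2.prems show ?case
  proof (induction "TJoin q1 q2" r rule: term_le.induct)
    case (cover i r)
    have "term_le J p (TJoin q1 q2)" using joinR2 by (auto intro: term_le.joinR2)
    then have "upper J i p \<le> upper J i (TJoin q1 q2)"
      using term_le_mono[of J p "TJoin q1 q2" i] cover by auto
    then show ?case using cover term_le.cover[of i J p r] by (blast intro: order_trans)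
  next
    case (joinL r)
    then show ?case using joinR2.IH by auto
  qed (auto intro: term_le.intros)
qed (auto intro: term_le.intros)

lemma term_le_bounds: "wft J p \<Longrightarrow> term_le J p (TJoin p q)" "wft J q \<Longrightarrow> term_le J q (TJoin p q)"
  "wft J p \<Longrightarrow> term_le J (TMeet p q) p" "wft J q \<Longrightarrow> term_le J (TMeet p q) q"
  by (auto intro: term_le.intros term_le_refl)

section \<open>Terms modulo the coproduct congruence\<close>

lemma cop_rel_wf:
  assumes "cop_rel I A mt jn Z p q"
    and "\<And>x y. x \<in> A \<Longrightarrow> y \<in> A \<Longrightarrow> mt x y \<in> A" "\<And>x y. x \<in> A \<Longrightarrow> y \<in> A \<Longrightarrow> jn x y \<in> A"
  shows "wf_term I A p \<and> wf_term I A q"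
  using assms(1) by induction (auto simp: assms(2,3))

text \<open>Functoriality of the coproduct in the index set and in the factor. It serves for
  restricting indices, for the isomorphism between \<open>EqL\<close> and \<open>eqv_on\<close>, and
  for the inclusion \<open>Some\<close>.\<close>

lemma cop_rel_map:
  assumes "cop_rel I A mt jn Z p q"
    and "\<And>i. i \<in> I \<Longrightarrow> s i \<in> I'" "\<And>x. x \<in> A \<Longrightarrow> f x \<in> A'" "\<And>z. z \<in> Z \<Longrightarrow> f z \<in> Z'"
    and mt: "\<And>x y. x \<in> A \<Longrightarrow> y \<in> A \<Longrightarrow> f (mt x y) = mt' (f x) (f y)"
    and jn: "\<And>x y. x \<in> A \<Longrightarrow> y \<in> A \<Longrightarrow> f (jn x y) = jn' (f x) (f y)"
  shows "cop_rel I' A' mt' jn' Z' (map_lterm s f p) (map_lterm s f q)"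
proof -
  have wf: "wf_term I A r \<Longrightarrow> wf_term I' A' (map_lterm s f r)" for r
    using assms(2,3) by (induction r) auto
  show ?thesis
    using assms(1)
  proof induction
    case (csym p q)
    from csym.IH show ?case by (rule cop_rel.csym)
  next
    case (ctrans p q r)
    then show ?case by (blast intro: cop_rel.ctrans)
  qed (auto simp: wf mt jn assms(2-4) intro: cop_rel.intros)
qed

declare ctrans [trans]

definition cop_le where "cop_le I A mt jn Z p q \<longleftrightarrow> cop_rel I A mt jn Z (TJoin p q) q"

context
  fixes I :: "'i set" and A :: "'b set" and mt jn :: "'b \<Rightarrow> 'b \<Rightarrow> 'b" and Z :: "'b set"
begin

abbreviation "cw \<equiv> wf_term I A"
abbreviation "cr \<equiv> cop_rel I A mt jn Z"
abbreviation "cl \<equiv> cop_le I A mt jn Z"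

lemma cr_join1: "cr p p' \<Longrightarrow> cw q \<Longrightarrow> cr (TJoin p q) (TJoin p' q)"
  and cr_join2: "cr p p' \<Longrightarrow> cw q \<Longrightarrow> cr (TJoin q p) (TJoin q p')"
  and cr_meet1: "cr p p' \<Longrightarrow> cw q \<Longrightarrow> cr (TMeet p q) (TMeet p' q)"
  and cr_meet2: "cr p p' \<Longrightarrow> cw q \<Longrightarrow> cr (TMeet q p) (TMeet q p')"
  by (auto intro: cjoin cmeet crefl)

lemma join_idem: "cw p \<Longrightarrow> cr (TJoin p p) p"
  by (rule ctrans[OF csym[OF cr_join2[OF meet_absorb]] join_absorb]) auto

lemma cl_meet_iff:
  assumes "cw p" "cw q"
  shows "cl p q \<longleftrightarrow> cr (TMeet p q) p"
proof
  assume "cl p q"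
  then have "cr (TMeet p q) (TMeet p (TJoin p q))"
    unfolding cop_le_def using assms by (intro cr_meet2 csym[of _ _ _ _ _ "TJoin p q"])
  then show "cr (TMeet p q) p" using assms by (blast intro: ctrans meet_absorb)
next
  assume "cr (TMeet p q) p"
  then have "cr (TJoin p q) (TJoin (TMeet p q) q)"
    using assms by (intro cr_join1 csym[of _ _ _ _ _ "TMeet p q"])
  also have "cr \<dots> (TJoin q (TMeet p q))" using assms by (intro join_comm) auto
  also have "cr \<dots> (TJoin q (TMeet q p))" using assms by (intro cr_join2 meet_comm)
  also have "cr \<dots> q" using assms by (intro join_absorb)
  finally show "cl p q" unfolding cop_le_def .
qed

lemma cl_refl: "cw p \<Longrightarrow> cl p p"
  unfolding cop_le_def by (rule join_idem)

lemma cl_trans: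
  assumes "cl p q" "cl q r" "cw p" "cw q" "cw r"
  shows "cl p r"
proof -
  have "cr (TJoin p r) (TJoin p (TJoin q r))"
    using assms unfolding cop_le_def by (intro cr_join2 csym[of _ _ _ _ _ "TJoin q r"])
  also have "cr \<dots> (TJoin (TJoin p q) r)" using assms by (intro csym[OF join_assoc])
  also have "cr \<dots> (TJoin q r)" using assms unfolding cop_le_def by (intro cr_join1)
  also have "cr \<dots> r" using assms unfolding cop_le_def by simp
  finally show ?thesis unfolding cop_le_def .
qed

lemma cl_antisym:
  assumes "cl p q" "cl q p" "cw p" "cw q"
  shows "cr p q"
proof -
  have "cr p (TJoin q p)" using assms unfolding cop_le_def by (blast intro: csym)
  also have "cr \<dots> (TJoin p q)" using assms by (intro join_comm)
  also have "cr \<dots> q" using assms unfolding cop_le_def by simp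
  finally show ?thesis .
qed

lemma cr_cl: "cr p q \<Longrightarrow> cw p \<Longrightarrow> cw q \<Longrightarrow> cl p q"
  unfolding cop_le_def by (rule ctrans[OF cr_join1 join_idem])

lemma cl_join_upper1: "cw p \<Longrightarrow> cw q \<Longrightarrow> cl p (TJoin p q)"
  unfolding cop_le_def by (rule ctrans[OF csym[OF join_assoc] cr_join1[OF join_idem]])

lemma cl_join_upper2: "cw p \<Longrightarrow> cw q \<Longrightarrow> cl q (TJoin p q)"
  by (rule cl_trans[OF cl_join_upper1[of q p] cr_cl[OF join_comm]]) auto

lemma cl_joinR1: "cl p q \<Longrightarrow> cw p \<Longrightarrow> cw q \<Longrightarrow> cw r \<Longrightarrow> cl p (TJoin q r)"
  by (rule cl_trans[OF _ cl_join_upper1]) auto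

lemma cl_joinR2: "cl p q \<Longrightarrow> cw p \<Longrightarrow> cw q \<Longrightarrow> cw r \<Longrightarrow> cl p (TJoin r q)"
  by (rule cl_trans[OF _ cl_join_upper2]) auto

lemma cl_joinL:
  assumes "cl p r" "cl q r" "cw p" "cw q" "cw r"
  shows "cl (TJoin p q) r"
proof -
  have "cr (TJoin (TJoin p q) r) (TJoin p (TJoin q r))" using assms by (intro join_assoc)
  also have "cr \<dots> (TJoin p r)" using assms unfolding cop_le_def by (intro cr_join2)
  also have "cr \<dots> r" using assms unfolding cop_le_def by simp
  finally show ?thesis unfolding cop_le_def .
qed

lemma cl_meet_lower2:
  assumes "cw p" "cw q"
  shows "cl (TMeet p q) q"
proof -
  have "cr (TJoin (TMeet p q) q) (TJoin q (TMeet p q))" using assms by (intro join_comm) auto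
  also have "cr \<dots> (TJoin q (TMeet q p))" using assms by (intro cr_join2 meet_comm)
  also have "cr \<dots> q" using assms by (intro join_absorb)
  finally show ?thesis unfolding cop_le_def .
qed

lemma cl_meet_lower1: "cw p \<Longrightarrow> cw q \<Longrightarrow> cl (TMeet p q) p"
  by (rule cl_trans[OF cr_cl[OF meet_comm] cl_meet_lower2]) auto

lemma cl_meetL2: "cl q r \<Longrightarrow> cw p \<Longrightarrow> cw q \<Longrightarrow> cw r \<Longrightarrow> cl (TMeet p q) r"
  by (rule cl_trans[OF cl_meet_lower2]) auto

lemma cl_meetL1: "cl p r \<Longrightarrow> cw p \<Longrightarrow> cw q \<Longrightarrow> cw r \<Longrightarrow> cl (TMeet p q) r"
  by (rule cl_trans[OF cl_meet_lower1]) auto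

lemma cl_meetR:
  assumes "cl p q" "cl p r" "cw p" "cw q" "cw r"
  shows "cl p (TMeet q r)"
proof -
  have "cr (TMeet p (TMeet q r)) (TMeet (TMeet p q) r)"
    using assms by (intro csym[OF meet_assoc])
  also have "cr \<dots> (TMeet p r)" using assms by (intro cr_meet1) (auto simp: cl_meet_iff)
  also have "cr \<dots> p" using assms by (simp add: cl_meet_iff)
  finally show ?thesis using assms by (simp add: cl_meet_iff)
qed

end

text \<open>A is the factor and K stands for its compact elements. Both are sets, since Eq \<Omega>
  will only be a part of a type. Compactness is stated for binary joins, which are the joins that
  terms can form.\<close>

locale dense_sublattice =
  fixes A K :: "'l::bounded_lattice_bot set"
  assumes sup_A: "x \<in> A \<Longrightarrow> y \<in> A \<Longrightarrow> sup x y \<in> A"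
    and inf_A: "x \<in> A \<Longrightarrow> y \<in> A \<Longrightarrow> inf x y \<in> A"
    and K_A: "K \<subseteq> A"
    and bot_K: "bot \<in> K"
    and sup_K: "x \<in> K \<Longrightarrow> y \<in> K \<Longrightarrow> sup x y \<in> K"
    and inf_K: "x \<in> K \<Longrightarrow> y \<in> K \<Longrightarrow> inf x y \<in> K"
    and dense: "x \<in> A \<Longrightarrow> y \<in> A \<Longrightarrow> (\<And>k. k \<in> K \<Longrightarrow> k \<le> x \<Longrightarrow> k \<le> y) \<Longrightarrow> x \<le> y"
    and compact: "k \<in> K \<Longrightarrow> x \<in> A \<Longrightarrow> y \<in> A \<Longrightarrow> k \<le> sup x y \<Longrightarrow>
      \<exists>k1\<in>K. \<exists>k2\<in>K. k1 \<le> x \<and> k2 \<le> y \<and> k \<le> sup k1 k2"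
begin

section \<open>The word problem: the order on terms decides the coproduct congruence\<close>

lemma bot_A: "bot \<in> A" using K_A bot_K by auto

lemma lower_A: "wf_term J A p \<Longrightarrow> lower i p \<in> A"
  by (induction p) (auto simp: bot_A sup_A inf_A)

lemma upper_A: "wf_term J A p \<Longrightarrow> upper J i p \<in> insert top.Top (top.Value ` A)"
proof (induction p)
  case (TJoin p q)
  then show ?case by (auto simp: sup_top_def sup_A)
next
  case (TMeet p q)
  then show ?case by (auto simp: inf_top_def inf_A bot_A)
qed auto

lemma cop_zero_le:
  assumes "i \<in> J" "wf_term J A p"
  shows "cop_le J A inf sup {bot} (Gen i bot) p"
  using assms(2)
proof (induction p)
  case (Gen j x)
  have "cop_rel J A inf sup {bot} (Gen j (sup bot x)) (TJoin (Gen j bot) (Gen j x))"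
    using Gen bot_A by (intro gen_join) auto
  moreover have "cop_rel J A inf sup {bot} (TJoin (Gen i bot) (Gen j x)) (TJoin (Gen j bot) (Gen j x))"
    using Gen bot_A assms by (intro cjoin gen_ident crefl) auto
  ultimately show ?case unfolding cop_le_def by (metis csym ctrans sup_bot_left)
next
  case (TJoin p q)
  then show ?case using bot_A assms(1) by (intro cl_joinR1) auto
next
  case (TMeet p q)
  then show ?case using bot_A assms(1) by (intro cl_meetR) auto
qed

lemma cop_gen_le:
  assumes "i \<in> J" "x \<in> A" "y \<in> A" "x \<le> y"
  shows "cop_le J A inf sup {bot} (Gen i x) (Gen i y)"
  unfolding cop_le_def
  by (metis assms csym gen_join sup.absorb2)

text \<open>Together with \<open>cop_upper\<close> this shows that the recursively computed covers
  are genuine bounds in the coproduct, which is what makes the rule \<open>cover\<close>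
  sound.\<close>

lemma cop_lower:
  assumes "i \<in> J" "wf_term J A p"
  shows "cop_le J A inf sup {bot} (Gen i (lower i p)) p"
  using assms(2)
proof (induction p)
  case (Gen j x)
  then show ?case using assms(1) by (auto intro: cl_refl cop_zero_le)
next
  case (TJoin p q)
  have "cop_le J A inf sup {bot} (Gen i (sup (lower i p) (lower i q))) (TJoin (Gen i (lower i p)) (Gen i (lower i q)))"
    using TJoin assms(1) by (intro cr_cl gen_join) (auto simp: lower_A sup_A)
  moreover have "cop_le J A inf sup {bot} (TJoin (Gen i (lower i p)) (Gen i (lower i q))) (TJoin p q)"
    using TJoin assms(1) by (auto simp: lower_A intro!: cl_joinL intro: cl_joinR1 cl_joinR2)
  ultimately show ?case
    using TJoin assms(1) by (auto simp: lower_A sup_A intro: cl_trans)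
next
  case (TMeet p q)
  have "cop_le J A inf sup {bot} (Gen i (inf (lower i p) (lower i q))) (Gen i (lower i p))"
    "cop_le J A inf sup {bot} (Gen i (inf (lower i p) (lower i q))) (Gen i (lower i q))"
    using TMeet assms(1) by (auto intro!: cop_gen_le simp: lower_A inf_A)
  then show ?case using TMeet assms(1)
    by (auto simp: lower_A inf_A intro!: cl_meetR intro: cl_trans)
qed

lemma cop_upper:
  assumes "i \<in> J" "wf_term J A p" "upper J i p = top.Value x"
  shows "cop_le J A inf sup {bot} p (Gen i x)"
  using assms(2,1,3)
proof (induction p arbitrary: x i)
  case (Gen j y)
  then show ?case
    by (auto intro!: cl_refl cop_zero_le split: if_splits simp: bot_A)
next
  case (TJoin p q)
  then obtain a b where ab: "upper J i p = top.Value a" "upper J i q = top.Value b" "x = sup a b"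
    by (cases "upper J i p"; cases "upper J i q") (auto simp: sup_top_def)
  then have A: "a \<in> A" "b \<in> A" using TJoin.prems upper_A[of J p i] upper_A[of J q i] by auto
  have "cop_le J A inf sup {bot} (Gen i a) (Gen i x)" "cop_le J A inf sup {bot} (Gen i b) (Gen i x)"
    using A ab TJoin.prems by (auto intro!: cop_gen_le simp: sup_A)
  then show ?case using TJoin.IH(1)[OF _ _ ab(1)] TJoin.IH(2)[OF _ _ ab(2)] TJoin.prems A ab(3)
    by (auto intro!: cl_joinL intro: cl_trans simp: sup_A)
next
  case (TMeet p q)
  \<comment> \<open>Needed for every index j: if the meet vanishes, it may do so in a factor other
    than i, and one passes from the zero of factor j to that of factor i.\<close>
  have main: "cop_le J A inf sup {bot} (TMeet p q) (Gen j y)"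
    if j: "j \<in> J" and e: "inf (upper J j p) (upper J j q) = top.Value y" for j y
  proof -
    have pq: "wf_term J A p" "wf_term J A q" using TMeet.prems by auto
    consider (p) "upper J j p = top.Value y" | (q) "upper J j q = top.Value y"
      | (pq) a b where "upper J j p = top.Value a" "upper J j q = top.Value b" "y = inf a b"
      using e by (cases "upper J j p"; cases "upper J j q") (auto simp: inf_top_def)
    then show ?thesis
    proof cases
      case p
      then show ?thesis using TMeet.IH(1)[OF _ _ p] pq j upper_A[of J p j] by (auto intro!: cl_meetL1)
    next
      case q
      then show ?thesis using TMeet.IH(2)[OF _ _ q] pq j upper_A[of J q j] by (auto intro!: cl_meetL2)
    next
      case (pq a b)
      have A: "a \<in> A" "b \<in> A" using TMeet.prems pq upper_A[of J p j] upper_A[of J q j] by auto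
      have "cop_le J A inf sup {bot} (TMeet p q) (TMeet (Gen j a) (Gen j b))"
        using TMeet.IH(1)[OF _ _ pq(1)] TMeet.IH(2)[OF _ _ pq(2)] TMeet.prems A j
        by (intro cl_meetR cl_meetL1[of _ _ _ _ _ p] cl_meetL2[of _ _ _ _ _ q]) auto
      moreover have "cop_le J A inf sup {bot} (TMeet (Gen j a) (Gen j b)) (Gen j y)"
        using A j pq(3) by (intro cr_cl csym[OF gen_meet]) (auto simp: inf_A intro: csym[OF gen_meet])
      ultimately show ?thesis
        using TMeet.prems A j pq(3) by (auto intro: cl_trans simp: inf_A)
    qed
  qed
  show ?case
  proof (cases "\<exists>j\<in>J. inf (upper J j p) (upper J j q) = top.Value bot")
    case True
    then obtain j where j: "j \<in> J" "inf (upper J j p) (upper J j q) = top.Value bot" by auto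
    have x: "x = bot" using True TMeet.prems by simp
    have "cop_le J A inf sup {bot} (Gen j bot) (Gen i bot)"
      using j TMeet.prems bot_A by (auto intro: cop_zero_le)
    then show ?thesis using main[OF j] j(1) TMeet.prems x bot_A by (auto intro: cl_trans)
  next
    case False
    then show ?thesis using main TMeet.prems by auto
  qed
qed

lemma term_le_sound:
  assumes "term_le J p q" "wf_term J A p" "wf_term J A q"
  shows "cop_le J A inf sup {bot} p q"
  using assms
proof induction
  case (cover i p q)
  then obtain x where x: "upper J i p = top.Value x" "x \<le> lower i q"
    by (cases "upper J i p") auto
  have A: "x \<in> A" "lower i q \<in> A" using cover x upper_A[of J p i] lower_A[of J q i] by auto
  have "cop_le J A inf sup {bot} p (Gen i x)" using cover x by (auto intro: cop_upper)
  moreover have "cop_le J A inf sup {bot} (Gen i x) (Gen i (lower i q))"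
    using cover x A by (auto intro: cop_gen_le)
  moreover have "cop_le J A inf sup {bot} (Gen i (lower i q)) q"
    using cover by (auto intro: cop_lower)
  ultimately show ?case using cover A by (meson cl_trans wf_term.simps)
qed (auto intro: cl_joinL cl_meetR cl_meetL1 cl_meetL2 cl_joinR1 cl_joinR2)

text \<open>Transitivity of the congruence is the case for which cut elimination was proved. With
  \<open>term_le_sound\<close>, the lattice order of the coproduct is now
  \<open>term_le\<close>.\<close>

lemma term_le_complete:
  fixes p q :: "('i, 'l) lterm"
  assumes "cop_rel J A inf sup {bot} p q"
  shows "term_le J p q \<and> term_le J q p"
proof -
  have wf: "cop_rel J A inf sup {bot} p q \<Longrightarrow> wft J p \<and> wft J q" for p q :: "('i, 'l) lterm"
    by (drule cop_rel_wf) (auto simp: sup_A inf_A wf_term_wft)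
  show ?thesis
    using assms
  proof induction
    case (crefl p)
    then show ?case using term_le_refl wf_term_wft by blast
  next
    case (ctrans p q r)
    then have "wft J p" "wft J q" "wft J r" using wf by auto
    then show ?case using ctrans.IH term_le_trans[of J p q r] term_le_trans[of J r q p] by auto
  next
    case (gen_join i x y)
    then show ?case by (auto intro!: cover[of i] joinL)
  next
    case (gen_meet i x y)
    then show ?case by (auto intro!: cover[of i] meetR simp: inf_top_def)
  next
    case (gen_ident i j z)
    then show ?case by (auto intro!: cover[of i])
  qed (auto intro!: joinL meetR intro: joinR1 joinR2 meetL1 meetL2 term_le_refl[OF wf_term_wft])
qed

end

section \<open>Approximation by terms over compact elements\<close>

context dense_sublattice
begin

text \<open>The added top counts as compact, so where a term has no upper cover, an approximating
  K-term can be required to have none either.\<close>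

definition "At = insert top.Top (top.Value ` A)"
definition "Kt = insert top.Top (top.Value ` K)"

lemma bot_Kt: "top.Value bot \<in> Kt"
  using bot_K by (auto simp: Kt_def)

lemma sup_Kt: "x \<in> Kt \<Longrightarrow> y \<in> Kt \<Longrightarrow> sup x y \<in> Kt"
  by (auto simp: Kt_def sup_K sup_top_def)

lemma inf_At: "x \<in> At \<Longrightarrow> y \<in> At \<Longrightarrow> inf x y \<in> At"
  by (auto simp: At_def inf_A inf_top_def)

lemma dense_top:
  assumes "x \<in> At" "y \<in> At" "\<not> x \<le> y"
  obtains k where "k \<in> Kt" "k \<le> x" "\<not> k \<le> y"
proof (cases x)
  case Top
  then show ?thesis using assms that[of "top.Top"] by (auto simp: Kt_def)
next
  case (Value a)
  then obtain b where b: "y = top.Value b" using assms by (cases y) auto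
  then obtain k where "k \<in> K" "k \<le> a" "\<not> k \<le> b"
    using dense[of a b] assms Value by (auto simp: At_def)
  then show ?thesis using that[of "top.Value k"] Value b by (auto simp: Kt_def)
qed

lemma compact_top:
  assumes "k \<in> Kt" "x \<in> At" "y \<in> At" "k \<le> sup x y"
  shows "\<exists>k1\<in>Kt. \<exists>k2\<in>Kt. k1 \<le> x \<and> k2 \<le> y \<and> k \<le> sup k1 k2"
proof -
  consider "x = top.Top" | "y = top.Top" | a b where "x = top.Value a" "y = top.Value b"
    by (cases x; cases y) auto
  then show ?thesis
  proof cases
    case 1
    then show ?thesis using assms bot_Kt
      by (intro bexI[of _ k] bexI[of _ "top.Value bot"]) auto
  next
    case 2
    then show ?thesis using assms bot_Kt
      by (intro bexI[of _ k] bexI[of _ "top.Value bot"]) auto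
  next
    case (3 a b)
    then obtain c where c: "k = top.Value c" "c \<le> sup a b" using assms
      by (cases k) (auto simp: sup_top_def)
    then obtain k1 k2 where "k1 \<in> K" "k2 \<in> K" "k1 \<le> a" "k2 \<le> b" "c \<le> sup k1 k2"
      using compact[of c a b] assms 3 by (auto simp: At_def Kt_def)
    then show ?thesis using c 3
      by (intro bexI[of _ "top.Value k1"] bexI[of _ "top.Value k2"]) (auto simp: Kt_def sup_top_def)
  qed
qed

lemma upper_At: "wf_term J A p \<Longrightarrow> upper J i p \<in> At"
  unfolding At_def by (rule upper_A)

lemma wf_K_A: "wf_term J K t \<Longrightarrow> wf_term J A t"
  by (erule wf_term_mono) (auto simp: K_A)

lemma wft_K: "wf_term J K t \<Longrightarrow> wft J t" and wft_A: "wf_term J A t \<Longrightarrow> wft J t"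
  by (auto intro: wf_term_wft)

lemma sub: "dense_sublattice K K"
  using sup_K inf_K bot_K by unfold_locales auto

lemma upper_Kt: "wf_term J K t \<Longrightarrow> upper J i t \<in> Kt"
  unfolding Kt_def by (rule dense_sublattice.upper_A[OF sub])

lemma term_le_bot: "i \<in> J \<Longrightarrow> term_le J (Gen i bot) p"
  by (rule cover[of i]) auto

text \<open>Induction on the derivation of t below the join. A \<open>cover\<close> step hands the
  question to compactness in one factor; a \<open>joinL\<close> step gives two pairs of K-terms,
  which are joined componentwise.\<close>

lemma term_le_join_compact:
  assumes "term_le J t r" "r = TJoin p q" "wf_term J K t" "wf_term J A p" "wf_term J A q"
  shows "\<exists>b1 b2. wf_term J K b1 \<and> wf_term J K b2 \<and> term_le J b1 p \<and> term_le J b2 q \<and> term_le J t (TJoin b1 b2)"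
  using assms
proof (induction rule: term_le.induct)
  case (cover i t r)
  then obtain k where k: "upper J i t = top.Value k" "k \<le> sup (lower i p) (lower i q)"
    by (cases "upper J i t") auto
  then have "k \<in> K" using upper_Kt[of J t i] cover by (auto simp: Kt_def)
  then obtain k1 k2 where "k1 \<in> K" "k2 \<in> K" "k1 \<le> lower i p" "k2 \<le> lower i q" "k \<le> sup k1 k2"
    using compact[of k "lower i p" "lower i q"] k cover lower_A[of J p i] lower_A[of J q i] by auto
  then show ?case using cover k
    by (intro exI[of _ "Gen i k1"] exI[of _ "Gen i k2"]) (auto intro!: term_le.cover[of i])
next
  case (joinL t1 r t2)
  obtain b1 b2 where b: "wf_term J K b1" "wf_term J K b2" "term_le J b1 p" "term_le J b2 q" "term_le J t1 (TJoin b1 b2)"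
    using joinL by auto
  obtain c1 c2 where c: "wf_term J K c1" "wf_term J K c2" "term_le J c1 p" "term_le J c2 q" "term_le J t2 (TJoin c1 c2)"
    using joinL by auto
  let ?d = "TJoin (TJoin b1 c1) (TJoin b2 c2)"
  have "term_le J (TJoin b1 b2) ?d" "term_le J (TJoin c1 c2) ?d"
    using b c by (auto intro!: term_le.joinL intro: term_le.joinR1 term_le.joinR2 term_le_refl wft_K wft_A)
  moreover have wfs: "wft J t1" "wft J t2" "wft J b1" "wft J b2" "wft J c1" "wft J c2"
    using b c joinL.prems by (auto intro: wft_K wft_A)
  ultimately have "term_le J t1 ?d" "term_le J t2 ?d"
    using term_le_trans[OF b(5), of ?d] term_le_trans[OF c(5), of ?d] by auto
  then show ?case using b c
    by (intro exI[of _ "TJoin b1 c1"] exI[of _ "TJoin b2 c2"]) (auto intro: term_le.joinL)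
next
  case (meetL1 t1 r t2)
  then show ?case by (auto intro: term_le.meetL1)
next
  case (meetL2 t1 r t2)
  then show ?case by (auto intro: term_le.meetL2)
next
  case (joinR1 t p' q')
  obtain i where "i \<in> J" using joinR1.prems(2) by (induction t) auto
  then show ?case using joinR1 bot_K
    by (intro exI[of _ t] exI[of _ "Gen i bot"]) (auto intro: term_le_bot term_le_bounds wft_K wft_A)
next
  case (joinR2 t q' p')
  obtain i where "i \<in> J" using joinR2.prems(2) by (induction t) auto
  then show ?case using joinR2 bot_K
    by (intro exI[of _ t] exI[of _ "Gen i bot"]) (auto intro: term_le_bot term_le_bounds wft_K wft_A)
qed auto

text \<open>One term t serves all indices, however many there are. What must be avoided is that an
  approximating term becomes zero by accident, since then all its upper covers would drop to
  zero.\<close>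

lemma upper_approx:
  assumes "wf_term J A p"
    and "\<And>i. i \<in> J \<Longrightarrow> \<kappa> i \<in> Kt" "\<And>i. i \<in> J \<Longrightarrow> \<kappa> i \<le> upper J i p"
  shows "\<exists>t. wf_term J K t \<and> term_le J t p \<and> (\<forall>i\<in>J. \<kappa> i \<le> upper J i t)"
  using assms
proof (induction p arbitrary: \<kappa>)
  case (Gen j x)
  show ?case
  proof (cases "x = bot")
    case True
    then show ?thesis using Gen bot_K
      by (intro exI[of _ "Gen j bot"]) (auto intro: term_le_bot)
  next
    case False
    have x: "x \<in> A" and j: "j \<in> J" using Gen by auto
    from Gen.prems(2)[OF j] Gen.prems(3)[OF j] obtain k where k: "\<kappa> j = top.Value k" "k \<in> K" "k \<le> x"
      by (cases "\<kappa> j") (auto simp: Kt_def)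
    \<comment> \<open>In the factors other than j the upper cover of \<open>Gen j x\<close> is the
      added top; joining the nonzero m to k keeps it so for the approximating generator, even if k
      is zero.\<close>
    obtain m where m: "m \<in> K" "m \<le> x" "m \<noteq> bot"
      using dense[OF x bot_A] False by (auto simp: bot_unique)
    have "sup k m \<noteq> bot" using m by simp
    moreover have "term_le J (Gen j (sup k m)) (Gen j x)" using j k m by (auto intro: term_le.cover[of j])
    ultimately show ?thesis using j k m
      by (intro exI[of _ "Gen j (sup k m)"]) (auto simp: sup_K)
  qed
next
  case (TJoin p q)
  have "\<exists>k1 k2. k1 \<in> Kt \<and> k2 \<in> Kt \<and> k1 \<le> upper J i p \<and> k2 \<le> upper J i q \<and> \<kappa> i \<le> sup k1 k2"
    if "i \<in> J" for i
  proof -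
    have "upper J i p \<in> At" "upper J i q \<in> At" using upper_At TJoin.prems by auto
    moreover have "\<kappa> i \<le> sup (upper J i p) (upper J i q)" using TJoin.prems(3)[OF that] by simp
    ultimately show ?thesis using compact_top[of "\<kappa> i"] TJoin.prems(2)[OF that] by blast
  qed
  then obtain k1 k2 where k: "\<And>i. i \<in> J \<Longrightarrow> k1 i \<in> Kt \<and> k2 i \<in> Kt \<and>
      k1 i \<le> upper J i p \<and> k2 i \<le> upper J i q \<and> \<kappa> i \<le> sup (k1 i) (k2 i)"
    by metis
  obtain t where t: "wf_term J K t" "term_le J t p" "\<forall>i\<in>J. k1 i \<le> upper J i t"
    using TJoin.IH(1)[of k1] k TJoin.prems by auto
  obtain u where u: "wf_term J K u" "term_le J u q" "\<forall>i\<in>J. k2 i \<le> upper J i u"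
    using TJoin.IH(2)[of k2] k TJoin.prems by auto
  have "\<kappa> i \<le> upper J i (TJoin t u)" if "i \<in> J" for i
  proof -
    have "\<kappa> i \<le> sup (k1 i) (k2 i)" using k that by auto
    also have "\<dots> \<le> sup (upper J i t) (upper J i u)" using t u that by (intro sup_mono) auto
    finally show ?thesis by simp
  qed
  then show ?case using t u by (intro exI[of _ "TJoin t u"]) (auto intro: term_le.intros)
next
  case (TMeet p q)
  show ?case
  proof (cases "\<exists>j\<in>J. inf (upper J j p) (upper J j q) = top.Value bot")
    case True
    then obtain j where "j \<in> J" by auto
    then show ?thesis using True TMeet.prems bot_K
      by (intro exI[of _ "Gen j bot"]) (auto intro: term_le_bot)
  next
    case False
    \<comment> \<open>The prescribed bound may be zero. It is enlarged to a nonzero k, so that the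
      meet of the two approximating terms vanishes in no factor and the exceptional clause of
      \<open>upper\<close> does not apply to it.\<close>
    have "\<exists>k. k \<in> Kt \<and> k \<noteq> top.Value bot \<and> \<kappa> i \<le> k \<and> k \<le> upper J i p \<and> k \<le> upper J i q"
      if i: "i \<in> J" for i
    proof -
      have "upper J i p \<in> At" "upper J i q \<in> At" using upper_At TMeet.prems by auto
      then have "inf (upper J i p) (upper J i q) \<in> At" by (rule inf_At)
      moreover have "\<not> inf (upper J i p) (upper J i q) \<le> top.Value bot"
        using False i by (metis le_Value_bot_iff)
      ultimately obtain k where k: "k \<in> Kt" "k \<le> inf (upper J i p) (upper J i q)" "\<not> k \<le> top.Value bot"
        using dense_top[of "inf (upper J i p) (upper J i q)" "top.Value bot"] bot_A by (auto simp: At_def)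
      have "\<kappa> i \<le> inf (upper J i p) (upper J i q)" using TMeet.prems(3)[OF i] False i by auto
      then show ?thesis using k TMeet.prems(2)[OF i]
        by (intro exI[of _ "sup k (\<kappa> i)"]) (auto simp: sup_Kt)
    qed
    then obtain k where k: "\<And>i. i \<in> J \<Longrightarrow>
        k i \<in> Kt \<and> k i \<noteq> top.Value bot \<and> \<kappa> i \<le> k i \<and> k i \<le> upper J i p \<and> k i \<le> upper J i q"
      by metis
    obtain t where t: "wf_term J K t" "term_le J t p" "\<forall>i\<in>J. k i \<le> upper J i t"
      using TMeet.IH(1)[of k] k TMeet.prems by auto
    obtain u where u: "wf_term J K u" "term_le J u q" "\<forall>i\<in>J. k i \<le> upper J i u"
      using TMeet.IH(2)[of k] k TMeet.prems by auto
    have le: "k i \<le> inf (upper J i t) (upper J i u)" if "i \<in> J" for i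
      using t u that by auto
    have "inf (upper J i t) (upper J i u) \<noteq> top.Value bot" if "i \<in> J" for i
      using le[OF that] k[OF that] by (metis le_Value_bot_iff)
    then have "\<kappa> i \<le> upper J i (TMeet t u)" if "i \<in> J" for i
      using le[OF that] k[OF that] by (auto intro: order_trans)
    then show ?thesis using t u by (intro exI[of _ "TMeet t u"]) (auto intro: term_le.intros)
  qed
qed

text \<open>The hard case is a meet p of p1 and p2 with q not a meet. If p <= q fails, then every
  rule that could yield it fails, and each failure has a K-term as witness: s1 below p1 and s2 below
  p2 against the rules for meets, s below p against those for joins, t below p against
  \<open>cover\<close> at all indices.\<close>

lemma term_le_dense:
  assumes "wf_term J A p" "wf_term J A q"
    and "\<And>t. wf_term J K t \<Longrightarrow> term_le J t p \<Longrightarrow> term_le J t q"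
  shows "term_le J p q"
  using assms
proof (induction "size p + size q" arbitrary: p q rule: less_induct)
  case less
  have wf: "wft J p" "wft J q" using less.prems by (auto intro: wft_A)
  have trans: "term_le J t r" if "term_le J t s" "term_le J s r" "wf_term J K t" "wf_term J A s" "wf_term J A r" for t s r
    using term_le_trans[of J t s r] that by (auto intro: wft_K wft_A)
  show ?case
  proof (cases "\<exists>q1 q2. q = TMeet q1 q2")
    case True
    then obtain q1 q2 where q: "q = TMeet q1 q2" by auto
    have "term_le J t q1 \<and> term_le J t q2" if "wf_term J K t" "term_le J t p" for t
      using less.prems(3)[OF that] trans[of t q] q less.prems that
      by (auto intro: term_le_bounds wft_K wft_A)
    then show ?thesis using less.hyps[of p q1] less.hyps[of p q2] less.prems q
      by (auto intro: term_le.meetR)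
  next
    case notmeet: False
    show ?thesis
    proof (cases p)
      case (Gen i x)
      then have i: "i \<in> J" "x \<in> A" using less.prems by auto
      have "k \<le> lower i q" if "k \<in> K" "k \<le> x" for k
      proof -
        have "term_le J (Gen i k) q" using that i Gen
          by (intro less.prems(3)) (auto intro: term_le.cover[of i])
        then show ?thesis using term_le_mono[of J "Gen i k" q i] i wf by auto
      qed
      then have "x \<le> lower i q" using i less.prems(2) by (intro dense[OF i(2) lower_A[of J q i]])
      then show ?thesis using i Gen by (auto intro: term_le.cover[of i])
    next
      case (TJoin p1 p2)
      have "term_le J p1 q" "term_le J p2 q"
        using TJoin less.prems(1,2) less.prems(3)[unfolded TJoin, OF _ term_le.joinR1]
          less.prems(3)[unfolded TJoin, OF _ term_le.joinR2] less.hyps[of p1 q] less.hyps[of p2 q]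
        by auto
      then show ?thesis using TJoin by (auto intro: term_le.joinL)
    next
      case (TMeet p1 p2)
      show ?thesis
      proof (rule ccontr)
        assume n: "\<not> term_le J p q"
        have wfp: "wf_term J A p1" "wf_term J A p2" using less.prems TMeet by auto
        obtain i0 where i0: "i0 \<in> J" using less.prems(1) by (induction p) auto
        have z: "wf_term J K (Gen i0 bot)" using i0 bot_K by auto
        have "\<not> term_le J p1 q" using n TMeet term_le.meetL1 by metis
        then obtain s1 where s1: "wf_term J K s1" "term_le J s1 p1" "\<not> term_le J s1 q"
          using less.hyps[of p1 q] less.prems TMeet by auto
        have "\<not> term_le J p2 q" using n TMeet term_le.meetL2 by metis
        then obtain s2 where s2: "wf_term J K s2" "term_le J s2 p2" "\<not> term_le J s2 q"
          using less.hyps[of p2 q] less.prems TMeet by auto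
        have "\<exists>s. wf_term J K s \<and> term_le J s p \<and>
            (\<forall>q1 q2. q = TJoin q1 q2 \<longrightarrow> \<not> term_le J s q1 \<and> \<not> term_le J s q2)"
        proof (cases "\<exists>q1 q2. q = TJoin q1 q2")
          case True
          then obtain q1 q2 where q: "q = TJoin q1 q2" by auto
          have "\<not> term_le J p q1" "\<not> term_le J p q2" using n q term_le.joinR1 term_le.joinR2 by metis+
          then obtain s3 s4 where s: "wf_term J K s3" "term_le J s3 p" "\<not> term_le J s3 q1"
            "wf_term J K s4" "term_le J s4 p" "\<not> term_le J s4 q2"
            using less.hyps[of p q1] less.hyps[of p q2] less.prems q by auto
          have "\<not> term_le J (TJoin s3 s4) q1" "\<not> term_le J (TJoin s3 s4) q2"
            using s q less.prems(2) trans[of s3 "TJoin s3 s4" q1] trans[of s4 "TJoin s3 s4" q2]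
            by (auto simp: wf_K_A intro: term_le_bounds wft_K wft_A)
          then show ?thesis using s q by (intro exI[of _ "TJoin s3 s4"]) (auto intro: term_le.joinL)
        next
          case False
          then show ?thesis using z i0 by (intro exI[of _ "Gen i0 bot"]) (auto intro: term_le_bot)
        qed
        then obtain s where s: "wf_term J K s" "term_le J s p"
          "\<And>q1 q2. q = TJoin q1 q2 \<Longrightarrow> \<not> term_le J s q1 \<and> \<not> term_le J s q2" by metis
        have "\<exists>k. k \<in> Kt \<and> k \<le> upper J i p \<and> \<not> k \<le> top.Value (lower i q)" if "i \<in> J" for i
        proof -
          have "\<not> upper J i p \<le> top.Value (lower i q)" using n that term_le.cover by metis
          then show ?thesis using dense_top[of "upper J i p" "top.Value (lower i q)"] less.prems upper_At lower_A
            by (metis At_def imageI insertCI)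
        qed
        then obtain \<kappa> where \<kappa>: "\<And>i. i \<in> J \<Longrightarrow>
            \<kappa> i \<in> Kt \<and> \<kappa> i \<le> upper J i p \<and> \<not> \<kappa> i \<le> top.Value (lower i q)" by metis
        obtain t where t: "wf_term J K t" "term_le J t p" "\<forall>i\<in>J. \<kappa> i \<le> upper J i t"
          using upper_approx[of J p \<kappa>] \<kappa> less.prems(1) by auto
        define w where "w = TJoin s t"
        have w: "wf_term J K w" "term_le J w p" using s t by (auto simp: w_def intro: term_le.joinL)
        have wp: "term_le J w p1" "term_le J w p2"
          using trans[of w p p1] trans[of w p p2] w TMeet less.prems wfp
          by (auto intro: term_le_bounds wft_K wft_A)
        \<comment> \<open>Each side of this meet lies above one of s1 and s2, while w puts s and t
          below v. Hence every rule that could end a derivation of v <= q contradicts one of the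
          four witnesses, although v lies below p.\<close>
        define v where "v = TMeet (TJoin w s1) (TJoin w s2)"
        have v: "wf_term J K v" "term_le J v p"
          using w s1 s2 wp TMeet by (auto simp: v_def intro: term_le.intros)
        have wv: "term_le J w v" unfolding v_def
          using w s1 s2 by (auto intro!: term_le.meetR term_le.joinR1 term_le_refl[OF wft_K])
        have sw: "term_le J s w" "term_le J t w" unfolding w_def using s t by (auto intro: term_le_bounds wft_K wft_A)
        have sv: "term_le J s v" "term_le J t v"
          using trans[OF sw(1) wv] trans[OF sw(2) wv] s t w v by (auto simp: wf_K_A)
        have nj: "\<not> term_le J (TJoin w s1) q" "\<not> term_le J (TJoin w s2) q"
          using s1 s2 w less.prems trans[of s1 "TJoin w s1" q] trans[of s2 "TJoin w s2" q]
          by (auto simp: wf_K_A intro: term_le_bounds wft_K wft_A)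
        have "term_le J v q" using less.prems(3) v by auto
        then show False
        proof cases
          case (cover i)
          have "\<kappa> i \<le> upper J i t" using t cover by auto
          also have "\<dots> \<le> upper J i v" using term_le_mono[OF sv(2), of i] t v cover by (auto intro: wft_K wft_A)
          finally have "\<kappa> i \<le> top.Value (lower i q)" using cover by auto
          then show False using \<kappa> cover by auto
        next
          case (joinR1 q1 q2)
          then show False using trans[OF sv(1), of q1] s v less.prems by (auto simp: wf_K_A)
        next
          case (joinR2 q2 q1)
          then show False using trans[OF sv(1), of q2] s v less.prems by (auto simp: wf_K_A)
        qed (use nj v_def notmeet in auto)
      qed
    qed
  qed
qed

end

section \<open>Representing a preordered lattice by equivalence relations\<close>

datatype 't pt = Root | Mid nat "'t pt" "'t pt" 't 't

text \<open>The points Mid 0, Mid 1, Mid 2 with arguments x y a b are the inner points of a chain from x to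
  y whose steps are labelled a, b, a, b.  The term rep lq c u is a canonical representative of the
  points at distance at most c from u, so being at distance at most c is an equivalence by
  construction.\<close>

primrec rep :: "('t \<Rightarrow> 't \<Rightarrow> bool) \<Rightarrow> 't \<Rightarrow> 't pt \<Rightarrow> 't pt" where
  "rep lq c Root = Root"
| "rep lq c (Mid k x y a b) =
    (if k = 0 then (if lq a c then rep lq c x else Mid 0 x y a b)
     else if k = 1 then
       (if lq b c then (if lq a c then rep lq c x else Mid 0 x y a b) else Mid 1 x y a b)
     else (if lq b c then rep lq c y else if lq a c then Mid 1 x y a b else Mid 2 x y a b))"

text \<open>A preorder instead of an order lets terms themselves serve as labels, without passing to
  congruence classes.\<close>

locale preordered_lattice =
  fixes C :: "'t set" and lq :: "'t \<Rightarrow> 't \<Rightarrow> bool" and j m :: "'t \<Rightarrow> 't \<Rightarrow> 't"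
  assumes refl: "a \<in> C \<Longrightarrow> lq a a"
    and trans: "lq a b \<Longrightarrow> lq b c \<Longrightarrow> a \<in> C \<Longrightarrow> b \<in> C \<Longrightarrow> c \<in> C \<Longrightarrow> lq a c"
    and j_C: "a \<in> C \<Longrightarrow> b \<in> C \<Longrightarrow> j a b \<in> C"
    and m_C: "a \<in> C \<Longrightarrow> b \<in> C \<Longrightarrow> m a b \<in> C"
    and j_ge1: "a \<in> C \<Longrightarrow> b \<in> C \<Longrightarrow> lq a (j a b)"
    and j_ge2: "a \<in> C \<Longrightarrow> b \<in> C \<Longrightarrow> lq b (j a b)"
    and j_least: "lq a c \<Longrightarrow> lq b c \<Longrightarrow> a \<in> C \<Longrightarrow> b \<in> C \<Longrightarrow> c \<in> C \<Longrightarrow> lq (j a b) c"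
    and m_le1: "a \<in> C \<Longrightarrow> b \<in> C \<Longrightarrow> lq (m a b) a"
    and m_le2: "a \<in> C \<Longrightarrow> b \<in> C \<Longrightarrow> lq (m a b) b"
    and m_greatest: "lq c a \<Longrightarrow> lq c b \<Longrightarrow> a \<in> C \<Longrightarrow> b \<in> C \<Longrightarrow> c \<in> C \<Longrightarrow> lq c (m a b)"
begin

text \<open>The last premise of Mid says that the distance of x and y is at most the join of a and b.\<close>

inductive_set points :: "'t pt set" where
  Root: "Root \<in> points"
| Mid: "k < 3 \<Longrightarrow> x \<in> points \<Longrightarrow> y \<in> points \<Longrightarrow> a \<in> C \<Longrightarrow> b \<in> C \<Longrightarrow>
    (\<And>c. c \<in> C \<Longrightarrow> lq a c \<Longrightarrow> lq b c \<Longrightarrow> rep lq c x = rep lq c y) \<Longrightarrow> Mid k x y a b \<in> points"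

definition agree :: "'t pt \<Rightarrow> 't pt \<Rightarrow> 't set" where
  "agree u v = {c \<in> C. rep lq c u = rep lq c v}"

definition is_filter :: "'t set \<Rightarrow> bool" where
  "is_filter S \<longleftrightarrow> S \<subseteq> C \<and> (\<forall>c\<in>S. \<forall>d\<in>C. lq c d \<longrightarrow> d \<in> S) \<and> (\<forall>c\<in>S. \<forall>d\<in>S. m c d \<in> S)"

lemma is_filter_C: "is_filter C"
  by (auto simp: is_filter_def m_C)

lemma is_filter_up: "a \<in> C \<Longrightarrow> is_filter {c \<in> C. lq a c}"
  by (auto simp: is_filter_def m_C m_greatest intro: trans)

lemma is_filter_Int: "is_filter S \<Longrightarrow> is_filter T \<Longrightarrow> is_filter (S \<inter> T)"
  unfolding is_filter_def by blast

lemma size_rep: "size (rep lq c u) \<le> size u"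
  by (induction u) auto

text \<open>Passing to an end of a chain strictly decreases the size, so a point no larger than a
  given chain point can have it as representative only if it lies on the same chain.\<close>

lemma rep_Mid_eq:
  "rep lq c u = Mid k x y a b \<Longrightarrow> size u \<le> size (Mid k x y a b) \<Longrightarrow> \<exists>k'. u = Mid k' x y a b"
proof (cases u)
  case (Mid k' x' y' a' b')
  assume *: "rep lq c u = Mid k x y a b" "size u \<le> size (Mid k x y a b)"
  have "size (rep lq c x') < size u" "size (rep lq c y') < size u"
    using size_rep[of c x'] size_rep[of c y'] Mid by auto
  then show ?thesis using * Mid by (auto split: if_splits)
qed auto

lemma agree_commute: "agree u v = agree v u"
  by (auto simp: agree_def)

text \<open>Outside its own chain, an inner point u is reached only through one fixed end w of the chain:
  the set of c relating u to v is the set of c above the label of u that relate w to v.\<close>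

lemma is_filter_agree_Mid:
  assumes u: "Mid k x y a b \<in> points" and v: "v \<in> points" "size v \<le> size (Mid k x y a b)"
    and IH: "\<And>w. w \<in> points \<Longrightarrow> size w < size (Mid k x y a b) \<Longrightarrow> is_filter (agree w v)"
  shows "is_filter (agree (Mid k x y a b) v)"
proof -
  from u have k: "k = 0 \<or> k = 1 \<or> k = 2" and xy: "x \<in> points" "y \<in> points" and C: "a \<in> C" "b \<in> C"
    and eq: "\<And>c. c \<in> C \<Longrightarrow> lq a c \<Longrightarrow> lq b c \<Longrightarrow> rep lq c x = rep lq c y"
    by (cases, auto)+
  let ?Fa = "{c \<in> C. lq a c}" and ?Fb = "{c \<in> C. lq b c}"
  have F: "is_filter ?Fa" "is_filter ?Fb" "is_filter (?Fa \<inter> ?Fb)"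
    using C by (auto intro: is_filter_up is_filter_Int)
  have ne: "rep lq c x \<noteq> Mid k' x y a b" "rep lq c y \<noteq> Mid k' x y a b" for c k'
    using size_rep[of c x] size_rep[of c y] by auto
  show ?thesis
  proof (cases "\<exists>k'. v = Mid k' x y a b")
    case True
    then obtain k' where v': "v = Mid k' x y a b" by auto
    then have k': "k' = 0 \<or> k' = 1 \<or> k' = 2" using v(1) by (auto elim: points.cases)
    \<comment> \<open>This is where three inner points are needed: between two of them, the way
      round through x and y uses every label of the direct way, so it adds nothing. On a shorter
      chain labelled a, b, a, the step b could be bypassed by any c above a that relates x and y,
      and the resulting set need not be a filter.\<close>
    have "rep lq c (Mid 0 x y a b) = rep lq c (Mid 1 x y a b) \<longleftrightarrow> lq b c"
      "rep lq c (Mid 1 x y a b) = rep lq c (Mid 2 x y a b) \<longleftrightarrow> lq a c"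
      "rep lq c (Mid 0 x y a b) = rep lq c (Mid 2 x y a b) \<longleftrightarrow> lq a c \<and> lq b c"
      if "c \<in> C" for c
      using eq[OF that] ne[of c] ne[of c, symmetric] by (cases "lq a c"; cases "lq b c"; simp)+
    then have "agree (Mid 0 x y a b) (Mid 1 x y a b) = ?Fb"
      "agree (Mid 1 x y a b) (Mid 2 x y a b) = ?Fa"
      "agree (Mid 0 x y a b) (Mid 2 x y a b) = ?Fa \<inter> ?Fb"
      unfolding agree_def by blast+
    moreover have "agree w w = C" for w by (simp add: agree_def)
    ultimately have "agree (Mid k x y a b) v \<in> {C, ?Fa, ?Fb, ?Fa \<inter> ?Fb}"
      using k k' unfolding v' by (elim disjE) (simp_all add: agree_commute)
    then show ?thesis using F is_filter_C by auto
  next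
    case False
    then have nv: "rep lq c v \<noteq> Mid k' x y a b" for c k'
      using rep_Mid_eq[of c v k' x y a b] v(2) by auto
    have s: "is_filter (agree x v)" "is_filter (agree y v)" using IH xy by auto
    consider "k = 0" | "k = 1" | "k = 2" using k by auto
    then show ?thesis
    proof cases
      case 1
      have "agree (Mid k x y a b) v = ?Fa \<inter> agree x v"
        using nv nv[symmetric] 1 by (auto simp: agree_def)
      then show ?thesis using s F by (auto intro: is_filter_Int)
    next
      case 2
      have "agree (Mid k x y a b) v = (?Fa \<inter> ?Fb) \<inter> agree x v"
        using nv nv[symmetric] 2 by (auto simp: agree_def)
      then show ?thesis using s F by (auto intro: is_filter_Int)
    next
      case 3
      have "agree (Mid k x y a b) v = ?Fb \<inter> agree y v"
        using nv nv[symmetric] 3 by (auto simp: agree_def)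
      then show ?thesis using s F by (auto intro: is_filter_Int)
    qed
  qed
qed

lemma is_filter_agree:
  assumes "u \<in> points" "v \<in> points"
  shows "is_filter (agree u v)"
  using assms
proof (induction "size u + size v" arbitrary: u v rule: less_induct)
  case less
  show ?case
  \<comment> \<open>The larger point is the one to unfold: only then is the other one small enough
    for \<open>rep_Mid_eq\<close>.\<close>
  proof (cases "size v \<le> size u")
    case True
    show ?thesis
    proof (cases u)
      case Root
      then have "v = Root" using True by (cases v) auto
      then show ?thesis using Root is_filter_C by (auto simp: agree_def)
    next
      case (Mid k x y a b)
      then show ?thesis using less True by (auto intro!: is_filter_agree_Mid)
    qed
  next
    case False
    show ?thesis
    proof (cases v)
      case Root
      then show ?thesis using False by auto
    next
      case (Mid k x y a b)
      have "is_filter (agree v u)" unfolding Mid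
        using less.prems False Mid less.hyps[of u] by (intro is_filter_agree_Mid) (auto simp: agree_commute[of _ u])
      then show ?thesis by (simp add: agree_commute)
    qed
  qed
qed

lemma rep_mono:
  assumes "rep lq c u = rep lq c v" "lq c d" "c \<in> C" "d \<in> C" "u \<in> points" "v \<in> points"
  shows "rep lq d u = rep lq d v"
  using is_filter_agree[of u v] assms unfolding is_filter_def agree_def by auto

lemma rep_meet:
  assumes "rep lq c u = rep lq c v" "rep lq d u = rep lq d v" "c \<in> C" "d \<in> C" "u \<in> points" "v \<in> points"
  shows "rep lq (m c d) u = rep lq (m c d) v"
  using is_filter_agree[of u v] assms unfolding is_filter_def agree_def by auto

text \<open>If the join of c and d relates u and v, monotonicity supplies the last premise of
  \<open>Mid\<close>, so the chain from u to v labelled c, d, c, d already lies in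
  \<open>points\<close>.\<close>

lemma rep_join_chain:
  assumes "rep lq (j c d) u = rep lq (j c d) v" "c \<in> C" "d \<in> C" "u \<in> points" "v \<in> points"
  obtains w1 w2 w3 where "w1 \<in> points" "w2 \<in> points" "w3 \<in> points"
    "rep lq c u = rep lq c w1" "rep lq d w1 = rep lq d w2"
    "rep lq c w2 = rep lq c w3" "rep lq d w3 = rep lq d v"
proof -
  have eq: "rep lq e u = rep lq e v" if "e \<in> C" "lq c e" "lq d e" for e
    using rep_mono[OF assms(1), of e] that assms by (auto simp: j_C j_least)
  have "Mid k u v c d \<in> points" if "k < 3" for k
    using assms eq that by (auto intro: points.Mid)
  then show ?thesis
    using that[of "Mid 0 u v c d" "Mid 1 u v c d" "Mid 2 u v c d"] assms eq[of c] eq[of d] refl by auto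
qed

text \<open>Faithfulness: on a loop at \<open>Root\<close> with every step labelled t, the first
  inner point is at distance exactly t from \<open>Root\<close>.\<close>

lemma rep_witness:
  assumes "t \<in> C"
  shows "Mid 0 Root Root t t \<in> points" "c \<in> C \<Longrightarrow> rep lq c Root = rep lq c (Mid 0 Root Root t t) \<longleftrightarrow> lq t c"
  using assms by (auto intro: points.intros)

end

section \<open>Equivalence relations attached to terms over the whole factor\<close>

context dense_sublattice
begin

lemma preordered_lattice_terms: "preordered_lattice (Collect (wf_term J K)) (term_le J) TJoin TMeet"
  by unfold_locales
    (auto intro: term_le_refl wft_K term_le_bounds joinL meetR term_le_trans)

definition pts :: "'i set \<Rightarrow> ('i, 'l) lterm pt set" where
  "pts J = preordered_lattice.points (Collect (wf_term J K)) (term_le J)"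

text \<open>The union of kernels is directed, since the K-terms below p are closed under joins; this
  is why it is again transitive.\<close>

definition ev :: "'i set \<Rightarrow> ('i, 'l) lterm \<Rightarrow> (('i, 'l) lterm pt \<times> ('i, 'l) lterm pt) set" where
  "ev J p = {(u, v). u \<in> pts J \<and> v \<in> pts J \<and>
     (\<exists>t. wf_term J K t \<and> term_le J t p \<and> rep (term_le J) t u = rep (term_le J) t v)}"

lemmas terms_rep_mono = preordered_lattice.rep_mono[OF preordered_lattice_terms, folded pts_def, simplified]
lemmas terms_rep_meet = preordered_lattice.rep_meet[OF preordered_lattice_terms, folded pts_def, simplified]
lemmas terms_rep_join_chain = preordered_lattice.rep_join_chain[OF preordered_lattice_terms, folded pts_def, simplified]
lemmas terms_rep_witness = preordered_lattice.rep_witness[OF preordered_lattice_terms, folded pts_def, simplified]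

lemma pts_Root: "Root \<in> pts J"
  unfolding pts_def by (rule preordered_lattice.points.Root[OF preordered_lattice_terms])

lemma set_pts: "u \<in> pts J \<Longrightarrow> set_pt u \<subseteq> Collect (wf_term J K)"
  unfolding pts_def
  by (erule preordered_lattice.points.induct[OF preordered_lattice_terms]) auto

lemma wf_term_index: "wf_term J X p \<Longrightarrow> \<exists>i. i \<in> J"
  by (induction p) auto

lemma term_le_trans_K:
  "term_le J t s \<Longrightarrow> term_le J s r \<Longrightarrow> wf_term J K t \<Longrightarrow> wf_term J A s \<Longrightarrow> wf_term J A r \<Longrightarrow> term_le J t r"
  using term_le_trans[of J t s r] by (auto intro: wft_K wft_A)

lemma ev_mono: "term_le J p q \<Longrightarrow> wf_term J A p \<Longrightarrow> wf_term J A q \<Longrightarrow> ev J p \<subseteq> ev J q"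
  unfolding ev_def using term_le_trans_K[of J _ p q] by blast

lemma ev_equiv:
  assumes "wf_term J A p"
  shows "equiv (pts J) (ev J p)"
proof (rule equivI)
  \<comment> \<open>Reflexivity requires at least one K-term below p; the zero generator at i is
    one.\<close>
  obtain i where i: "i \<in> J" using assms wf_term_index by metis
  show "ev J p \<subseteq> pts J \<times> pts J" by (auto simp: ev_def)
  show "refl_on (pts J) (ev J p)"
    using i bot_K term_le_bot[OF i, of p] by (auto simp: refl_on_def ev_def intro!: exI[of _ "Gen i bot"])
  show "sym (ev J p)" unfolding ev_def sym_def by (auto intro: sym)
  show "trans (ev J p)"
  proof (rule transI)
    fix u v w assume "(u, v) \<in> ev J p" "(v, w) \<in> ev J p"
    then obtain s t where st: "u \<in> pts J" "v \<in> pts J" "w \<in> pts J" "wf_term J K s" "wf_term J K t"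
      "term_le J s p" "term_le J t p" "rep (term_le J) s u = rep (term_le J) s v" "rep (term_le J) t v = rep (term_le J) t w"
      by (auto simp: ev_def)
    have "term_le J s (TJoin s t)" "term_le J t (TJoin s t)" using st by (auto intro: term_le_bounds wft_K)
    then have "rep (term_le J) (TJoin s t) u = rep (term_le J) (TJoin s t) v"
      "rep (term_le J) (TJoin s t) v = rep (term_le J) (TJoin s t) w"
      using terms_rep_mono[of J s u v "TJoin s t"] terms_rep_mono[of J t v w "TJoin s t"] st by auto
    then show "(u, w) \<in> ev J p" using st unfolding ev_def
      by (auto intro!: exI[of _ "TJoin s t"] joinL)
  qed
qed

lemma ev_meet:
  assumes "wf_term J A p" "wf_term J A q"
  shows "ev J (TMeet p q) = ev J p \<inter> ev J q"
proof
  show "ev J (TMeet p q) \<subseteq> ev J p \<inter> ev J q"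
    using assms by (intro Int_greatest ev_mono) (auto intro: term_le_bounds wft_A)
  show "ev J p \<inter> ev J q \<subseteq> ev J (TMeet p q)"
  proof
    fix z assume "z \<in> ev J p \<inter> ev J q"
    then obtain u v s t where st: "z = (u, v)" "u \<in> pts J" "v \<in> pts J" "wf_term J K s" "wf_term J K t"
      "term_le J s p" "term_le J t q" "rep (term_le J) s u = rep (term_le J) s v" "rep (term_le J) t u = rep (term_le J) t v"
      by (auto simp: ev_def)
    then show "z \<in> ev J (TMeet p q)" unfolding ev_def
      by (auto intro!: exI[of _ "TMeet s t"] meetR terms_rep_meet intro: meetL1 meetL2)
  qed
qed

lemma ev_join:
  assumes "wf_term J A p" "wf_term J A q"
  shows "ev J (TJoin p q) = (ev J p \<union> ev J q)\<^sup>+"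
proof
  have "ev J p \<subseteq> ev J (TJoin p q)" "ev J q \<subseteq> ev J (TJoin p q)"
    using assms by (intro ev_mono; auto intro: term_le_bounds wft_A)+
  moreover have "trans (ev J (TJoin p q))"
    using ev_equiv[of J "TJoin p q"] assms by (auto simp: equiv_def)
  ultimately show "(ev J p \<union> ev J q)\<^sup>+ \<subseteq> ev J (TJoin p q)"
    by (metis Un_least trancl_id trancl_mono_subset)
  show "ev J (TJoin p q) \<subseteq> (ev J p \<union> ev J q)\<^sup>+"
  proof
    fix z assume "z \<in> ev J (TJoin p q)"
    then obtain u v t where t: "z = (u, v)" "u \<in> pts J" "v \<in> pts J" "wf_term J K t"
      "term_le J t (TJoin p q)" "rep (term_le J) t u = rep (term_le J) t v"
      by (auto simp: ev_def)
    \<comment> \<open>Compactness replaces t by a join of K-terms b below p and c below q. The chain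
      for b and c then connects u to v by steps alternating between \<open>ev J p\<close> and
      \<open>ev J q\<close>.\<close>
    obtain b c where bc: "wf_term J K b" "wf_term J K c" "term_le J b p" "term_le J c q" "term_le J t (TJoin b c)"
      using term_le_join_compact[OF t(5) refl t(4) assms] by auto
    then have "rep (term_le J) (TJoin b c) u = rep (term_le J) (TJoin b c) v"
      using terms_rep_mono[of J t u v "TJoin b c"] t by auto
    then obtain w1 w2 w3 where w: "w1 \<in> pts J" "w2 \<in> pts J" "w3 \<in> pts J"
      "rep (term_le J) b u = rep (term_le J) b w1" "rep (term_le J) c w1 = rep (term_le J) c w2"
      "rep (term_le J) b w2 = rep (term_le J) b w3" "rep (term_le J) c w3 = rep (term_le J) c v"
      using terms_rep_join_chain[of J b c u v] bc t by metis
    have "(u, w1) \<in> ev J p" "(w1, w2) \<in> ev J q" "(w2, w3) \<in> ev J p" "(w3, v) \<in> ev J q"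
      using w t bc by (auto simp: ev_def)
    then show "z \<in> (ev J p \<union> ev J q)\<^sup>+"
      unfolding t(1) by (meson UnCI r_into_trancl trancl_trans)
  qed
qed

text \<open>By density only K-terms t below p have to be tested, and the loop labelled t turns t <=
  q into the membership of a single pair.\<close>

lemma ev_reflect:
  assumes "ev J p \<subseteq> ev J q" "wf_term J A p" "wf_term J A q"
  shows "term_le J p q"
proof (rule term_le_dense[OF assms(2,3)])
  fix t assume t: "wf_term J K t" "term_le J t p"
  have "term_le J t t" using t by (auto intro: term_le_refl wft_K)
  then have "(Root, Mid 0 Root Root t t) \<in> ev J p"
    using t pts_Root[of J] terms_rep_witness[OF t(1)] unfolding ev_def by auto
  then have "(Root, Mid 0 Root Root t t) \<in> ev J q" using assms(1) by blast
  then obtain s where s: "wf_term J K s" "term_le J s q"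
    "rep (term_le J) s Root = rep (term_le J) s (Mid 0 Root Root t t)"
    unfolding ev_def by blast
  then have "term_le J t s" using terms_rep_witness(2)[OF t(1) s(1)] by auto
  then show "term_le J t q" using s t assms term_le_trans_K[of J t s q] by (auto intro: wf_K_A)
qed

lemma ev_eq_iff:
  assumes "wf_term J A p" "wf_term J A q"
  shows "ev J p = ev J q \<longleftrightarrow> cop_rel J A inf sup {bot} p q"
proof
  assume "ev J p = ev J q"
  then have "term_le J p q" "term_le J q p" using ev_reflect[of J p q] ev_reflect[of J q p] assms by auto
  then show "cop_rel J A inf sup {bot} p q" using assms by (intro cl_antisym term_le_sound)
next
  assume "cop_rel J A inf sup {bot} p q"
  then show "ev J p = ev J q" using term_le_complete ev_mono assms by blast
qed

text \<open>Zero is not represented by the identity, because labels equivalent to zero identify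
  distinct points. Its kernel is described here so that it can be factored out later.\<close>

lemma ev_bot:
  assumes "i \<in> J"
  shows "ev J (Gen i bot) = {(u, v). u \<in> pts J \<and> v \<in> pts J \<and>
    rep (term_le J) (Gen i bot) u = rep (term_le J) (Gen i bot) v}"
proof -
  let ?z = "Gen i bot"
  have z: "wf_term J K ?z" "term_le J ?z ?z" using assms bot_K term_le_bot by auto
  have "rep (term_le J) ?z u = rep (term_le J) ?z v"
    if "u \<in> pts J" "v \<in> pts J" "wf_term J K t" "term_le J t ?z" "rep (term_le J) t u = rep (term_le J) t v" for u v t
    using terms_rep_mono[of J t u v ?z] that z by blast
  then show ?thesis unfolding ev_def using z by blast
qed

lemma ev_bot_least:
  assumes "i \<in> J" "wf_term J A p"
  shows "ev J (Gen i bot) \<subseteq> ev J p"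
  using assms by (intro ev_mono term_le_bot) (auto simp: bot_A)

end

section \<open>Coding and transport to the base set\<close>

lemma infinite_times_lepoll: "infinite X \<Longrightarrow> X \<times> X \<lesssim> X"
  using card_of_Times_same_infinite[of X]
  by (simp add: lepoll_def card_of_ordLeq ordIso_iff_ordLeq)

text \<open>In this and the next two codings f is a pairing injection on the target set, and the
  values of t are tags that distinguish the constructors.\<close>

primrec code_list :: "('a \<times> 'a \<Rightarrow> 'a) \<Rightarrow> (nat \<Rightarrow> 'a) \<Rightarrow> 'a list \<Rightarrow> 'a" where
  "code_list f t [] = f (t 0, t 0)"
| "code_list f t (x # xs) = f (t 1, f (x, code_list f t xs))"

primrec code_term ::
  "('a \<times> 'a \<Rightarrow> 'a) \<Rightarrow> (nat \<Rightarrow> 'a) \<Rightarrow> ('i \<Rightarrow> 'a) \<Rightarrow> ('b \<Rightarrow> 'a) \<Rightarrow> ('i, 'b) lterm \<Rightarrow> 'a" where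
  "code_term f t g h (Gen i x) = f (t 0, f (g i, h x))"
| "code_term f t g h (TJoin p q) = f (t 1, f (code_term f t g h p, code_term f t g h q))"
| "code_term f t g h (TMeet p q) = f (t 2, f (code_term f t g h p, code_term f t g h q))"

primrec code_pt :: "('a \<times> 'a \<Rightarrow> 'a) \<Rightarrow> (nat \<Rightarrow> 'a) \<Rightarrow> ('b \<Rightarrow> 'a) \<Rightarrow> 'b pt \<Rightarrow> 'a" where
  "code_pt f t g Root = f (t 0, t 0)"
| "code_pt f t g (Mid k x y a b) =
    f (t (Suc k), f (f (code_pt f t g x, code_pt f t g y), f (g a, g b)))"

context
  fixes X :: "'a set" and f :: "'a \<times> 'a \<Rightarrow> 'a" and t :: "nat \<Rightarrow> 'a"
  assumes f: "inj_on f (X \<times> X)" "f ` (X \<times> X) \<subseteq> X" and t: "inj t" "range t \<subseteq> X"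
begin

lemma pair_in: "x \<in> X \<Longrightarrow> y \<in> X \<Longrightarrow> f (x, y) \<in> X"
  using f(2) by auto

lemma pair_eq:
  "x \<in> X \<Longrightarrow> y \<in> X \<Longrightarrow> x' \<in> X \<Longrightarrow> y' \<in> X \<Longrightarrow> f (x, y) = f (x', y') \<longleftrightarrow> x = x' \<and> y = y'"
  by (subst inj_on_eq_iff[OF f(1)]) auto

lemma tag_in: "t n \<in> X" and tag_eq: "t m = t n \<longleftrightarrow> m = n"
  using t by (auto dest: injD)

lemmas code_simps = pair_in pair_eq tag_in tag_eq

lemma code_list_in: "set xs \<subseteq> X \<Longrightarrow> code_list f t xs \<in> X"
  by (induction xs) (auto simp: code_simps)

lemma code_list_inj: "set xs \<subseteq> X \<Longrightarrow> set ys \<subseteq> X \<Longrightarrow> code_list f t xs = code_list f t ys \<Longrightarrow> xs = ys"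
proof (induction xs arbitrary: ys)
  case Nil
  then show ?case by (cases ys) (simp_all add: code_simps code_list_in)
next
  case (Cons x xs)
  from Cons.prems obtain ys' where "ys = x # ys'" "set ys' \<subseteq> X" "code_list f t xs = code_list f t ys'"
    by (cases ys) (simp_all add: code_simps code_list_in)
  then show ?case using Cons.IH[of ys'] Cons.prems(1) by simp
qed

context
  fixes I :: "'i set" and K :: "'b set" and g h
  assumes g: "inj_on g I" "g ` I \<subseteq> X" and h: "inj_on h K" "h ` K \<subseteq> X"
begin

lemma gen_code: "i \<in> I \<Longrightarrow> g i \<in> X" "k \<in> K \<Longrightarrow> h k \<in> X"
    "i \<in> I \<Longrightarrow> i' \<in> I \<Longrightarrow> g i = g i' \<longleftrightarrow> i = i'" "k \<in> K \<Longrightarrow> k' \<in> K \<Longrightarrow> h k = h k' \<longleftrightarrow> k = k'"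
  using g h by (auto simp: inj_on_eq_iff)

lemma code_term_in: "wf_term I K p \<Longrightarrow> code_term f t g h p \<in> X"
  by (induction p) (auto simp: code_simps gen_code)

lemma code_term_inj:
  "wf_term I K p \<Longrightarrow> wf_term I K q \<Longrightarrow> code_term f t g h p = code_term f t g h q \<Longrightarrow> p = q"
proof (induction p arbitrary: q)
  case (Gen i x)
  then show ?case by (cases q) (simp_all add: code_simps gen_code code_term_in)
next
  case (TJoin p1 p2)
  from TJoin.prems obtain q1 q2 where "q = TJoin q1 q2" "wf_term I K q1" "wf_term I K q2"
    "code_term f t g h p1 = code_term f t g h q1" "code_term f t g h p2 = code_term f t g h q2"
    by (cases q) (simp_all add: code_simps gen_code code_term_in)
  then show ?case using TJoin.IH(1)[of q1] TJoin.IH(2)[of q2] TJoin.prems(1) by simp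
next
  case (TMeet p1 p2)
  from TMeet.prems obtain q1 q2 where "q = TMeet q1 q2" "wf_term I K q1" "wf_term I K q2"
    "code_term f t g h p1 = code_term f t g h q1" "code_term f t g h p2 = code_term f t g h q2"
    by (cases q) (simp_all add: code_simps gen_code code_term_in)
  then show ?case using TMeet.IH(1)[of q1] TMeet.IH(2)[of q2] TMeet.prems(1) by simp
qed

end

context
  fixes K :: "'b set" and h
  assumes h: "inj_on h K" "h ` K \<subseteq> X"
begin

lemma pt_label_code: "k \<in> K \<Longrightarrow> h k \<in> X" "k \<in> K \<Longrightarrow> k' \<in> K \<Longrightarrow> h k = h k' \<longleftrightarrow> k = k'"
  using h by (auto simp: inj_on_eq_iff)

lemma code_pt_in: "set_pt u \<subseteq> K \<Longrightarrow> code_pt f t h u \<in> X"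
  by (induction u) (auto simp: code_simps pt_label_code)

lemma code_pt_inj:
  "set_pt u \<subseteq> K \<Longrightarrow> set_pt v \<subseteq> K \<Longrightarrow> code_pt f t h u = code_pt f t h v \<Longrightarrow> u = v"
proof (induction u arbitrary: v)
  case Root
  then show ?case by (cases v) (simp_all add: code_simps pt_label_code code_pt_in)
next
  case (Mid k x y a b)
  from Mid.prems obtain x' y' where "v = Mid k x' y' a b" "set_pt x' \<subseteq> K" "set_pt y' \<subseteq> K"
    "code_pt f t h x = code_pt f t h x'" "code_pt f t h y = code_pt f t h y'"
    by (cases v) (simp_all add: code_simps pt_label_code code_pt_in)
  then show ?case using Mid.IH(1)[of x'] Mid.IH(2)[of y'] Mid.prems(1) by simp
qed

end

end

lemma infinite_coding:
  assumes "infinite (X :: 'a set)"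
  obtains f :: "'a \<times> 'a \<Rightarrow> 'a" and t :: "nat \<Rightarrow> 'a"
  where "inj_on f (X \<times> X)" "f ` (X \<times> X) \<subseteq> X" "inj t" "range t \<subseteq> X"
proof -
  obtain f where "inj_on f (X \<times> X)" "f ` (X \<times> X) \<subseteq> X"
    using infinite_times_lepoll[OF assms] unfolding lepoll_def by auto
  moreover obtain t :: "nat \<Rightarrow> 'a" where "inj t" "range t \<subseteq> X"
    using infinite_countable_subset[OF assms] by auto
  ultimately show ?thesis by (rule that)
qed

lemma lists_lepoll_infinite: "infinite (X :: 'a set) \<Longrightarrow> lists X \<lesssim> X"
proof -
  assume "infinite X"
  then obtain f :: "'a \<times> 'a \<Rightarrow> 'a" and t :: "nat \<Rightarrow> 'a" where ft: "inj_on f (X \<times> X)" "f ` (X \<times> X) \<subseteq> X" "inj t" "range t \<subseteq> X"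
    by (rule infinite_coding)
  show ?thesis unfolding lepoll_def
    using code_list_in[OF ft] code_list_inj[OF ft]
    by (intro exI[of _ "code_list f t"]) (auto simp: inj_on_def lists_eq_set)
qed

lemma terms_lepoll_infinite:
  assumes "infinite (X :: 'a set)" "I \<lesssim> X" "K \<lesssim> X"
  shows "Collect (wf_term I K) \<lesssim> X"
proof -
  obtain f :: "'a \<times> 'a \<Rightarrow> 'a" and t :: "nat \<Rightarrow> 'a" where ft: "inj_on f (X \<times> X)" "f ` (X \<times> X) \<subseteq> X" "inj t" "range t \<subseteq> X"
    using assms(1) by (rule infinite_coding)
  obtain g h where gh: "inj_on g I" "g ` I \<subseteq> X" "inj_on h K" "h ` K \<subseteq> X"
    using assms unfolding lepoll_def by auto
  show ?thesis unfolding lepoll_def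
    using code_term_in[OF ft gh] code_term_inj[OF ft gh]
    by (intro exI[of _ "code_term f t g h"]) (auto simp: inj_on_def)
qed

lemma pts_lepoll_infinite:
  assumes "infinite (X :: 'a set)" "K \<lesssim> X"
  shows "{u. set_pt u \<subseteq> K} \<lesssim> X"
proof -
  obtain f :: "'a \<times> 'a \<Rightarrow> 'a" and t :: "nat \<Rightarrow> 'a" where ft: "inj_on f (X \<times> X)" "f ` (X \<times> X) \<subseteq> X" "inj t" "range t \<subseteq> X"
    using assms(1) by (rule infinite_coding)
  obtain h where h: "inj_on h K" "h ` K \<subseteq> X"
    using assms unfolding lepoll_def by auto
  show ?thesis unfolding lepoll_def
    using code_pt_in[OF ft h] code_pt_inj[OF ft h]
    by (intro exI[of _ "code_pt f t h"]) (auto simp: inj_on_def)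
qed

lemma Fpow_lepoll_infinite:
  assumes "infinite X"
  shows "Fpow X \<lesssim> X"
proof -
  have "Fpow X = set ` lists X"
    using finite_list by (auto simp: Fpow_def lists_eq_set)
  then show ?thesis
    using image_lepoll[of set "lists X"] lists_lepoll_infinite[OF assms] by (metis lepoll_trans)
qed

text \<open>The map \<kappa> may be neither injective nor onto; a point of X outside its image forms
  a class of its own.\<close>

definition push :: "'b set \<Rightarrow> ('a \<Rightarrow> 'b) \<Rightarrow> ('a \<times> 'a) set \<Rightarrow> ('b \<times> 'b) set" where
  "push X \<kappa> R = Id_on X \<union> map_prod \<kappa> \<kappa> ` R"

lemma push_I: "(u, v) \<in> R \<Longrightarrow> (\<kappa> u, \<kappa> v) \<in> push X \<kappa> R"
  unfolding push_def by (rule UnI2, rule image_eqI[of _ _ "(u, v)"]) auto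

context
  fixes S :: "'a set" and X :: "'b set" and \<kappa> :: "'a \<Rightarrow> 'b" and E :: "('a \<times> 'a) set"
  assumes \<kappa>: "\<kappa> ` S \<subseteq> X" and E: "E = {(u, v). u \<in> S \<and> v \<in> S \<and> \<kappa> u = \<kappa> v}"
begin

text \<open>Two preimages of the same point are related by E, hence by R, so membership may be
  tested on any choice of preimages.\<close>

lemma push_iff:
  assumes "equiv S R" "E \<subseteq> R" "u \<in> S" "v \<in> S"
  shows "(\<kappa> u, \<kappa> v) \<in> push X \<kappa> R \<longleftrightarrow> (u, v) \<in> R"
proof
  have tr: "trans R" "refl_on S R" "R \<subseteq> S \<times> S" using assms by (auto simp: equiv_def)
  assume "(\<kappa> u, \<kappa> v) \<in> push X \<kappa> R"
  then consider "\<kappa> u = \<kappa> v" | u' v' where "(u', v') \<in> R" "\<kappa> u = \<kappa> u'" "\<kappa> v = \<kappa> v'"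
    by (auto simp: push_def)
  then show "(u, v) \<in> R"
  proof cases
    case 1
    then show ?thesis using assms E by auto
  next
    case 2
    then have "(u, u') \<in> R" "(v', v) \<in> R" using assms E tr by auto
    then show ?thesis using 2 tr by (meson transD)
  qed
qed (rule push_I)

lemma push_cases:
  assumes "(x, y) \<in> push X \<kappa> R" "R \<subseteq> S \<times> S"
  obtains "x = y" "x \<in> X" | u v where "x = \<kappa> u" "y = \<kappa> v" "u \<in> S" "v \<in> S" "(u, v) \<in> R"
  using assms by (auto simp: push_def)

lemma push_equiv:
  assumes "equiv S R" "E \<subseteq> R"
  shows "equiv X (push X \<kappa> R)"
proof (rule equivI)
  have R: "trans R" "sym R" "R \<subseteq> S \<times> S" using assms by (auto simp: equiv_def)
  show "push X \<kappa> R \<subseteq> X \<times> X" using R \<kappa> by (auto simp: push_def)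
  show "refl_on X (push X \<kappa> R)" by (auto simp: refl_on_def push_def)
  show "sym (push X \<kappa> R)"
  proof (rule symI)
    fix x y assume "(x, y) \<in> push X \<kappa> R"
    from this R(3) show "(y, x) \<in> push X \<kappa> R"
    proof (cases rule: push_cases)
      case 1
      then show ?thesis by (auto simp: push_def)
    next
      case (2 u v)
      then show ?thesis using R(2) by (auto intro: push_I dest: symD)
    qed
  qed
  show "trans (push X \<kappa> R)"
  proof (rule transI)
    fix x y z assume a: "(x, y) \<in> push X \<kappa> R" and b: "(y, z) \<in> push X \<kappa> R"
    from a R(3) show "(x, z) \<in> push X \<kappa> R"
    proof (cases rule: push_cases)
      case 1
      then show ?thesis using b by simp
    next
      case (2 u v)
      note uv = this
      from b R(3) show ?thesis
      proof (cases rule: push_cases)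
        case 1
        then show ?thesis using a by simp
      next
        case (2 v' w)
        then have "(v, w) \<in> R" using push_iff[OF assms, of v w] uv b by auto
        then have "(u, w) \<in> R" using uv R by (meson transD)
        then show ?thesis using push_iff[OF assms, of u w] uv 2 by auto
      qed
    qed
  qed
qed

lemma push_mono: "R \<subseteq> R' \<Longrightarrow> push X \<kappa> R \<subseteq> push X \<kappa> R'"
  by (auto simp: push_def)

lemma push_Int:
  assumes "equiv S R" "E \<subseteq> R" "equiv S R'" "E \<subseteq> R'"
  shows "push X \<kappa> (R \<inter> R') = push X \<kappa> R \<inter> push X \<kappa> R'"
proof
  show "push X \<kappa> (R \<inter> R') \<subseteq> push X \<kappa> R \<inter> push X \<kappa> R'" by (simp add: push_mono)
  have R: "R \<subseteq> S \<times> S" using assms by (auto simp: equiv_def)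
  show "push X \<kappa> R \<inter> push X \<kappa> R' \<subseteq> push X \<kappa> (R \<inter> R')"
  proof (rule subrelI)
    fix x y assume "(x, y) \<in> push X \<kappa> R \<inter> push X \<kappa> R'"
    then have a: "(x, y) \<in> push X \<kappa> R" and b: "(x, y) \<in> push X \<kappa> R'" by auto
    from a R show "(x, y) \<in> push X \<kappa> (R \<inter> R')"
    proof (cases rule: push_cases)
      case 1
      then show ?thesis by (auto simp: push_def)
    next
      case (2 u v)
      then have "(u, v) \<in> R'" using push_iff[OF assms(3,4)] b by auto
      then show ?thesis using 2 by (auto intro: push_I)
    qed
  qed
qed

lemma push_trancl:
  assumes "equiv S R" "E \<subseteq> R" "equiv S R'" "E \<subseteq> R'" "equiv S ((R \<union> R')\<^sup>+)"
  shows "push X \<kappa> ((R \<union> R')\<^sup>+) = (push X \<kappa> R \<union> push X \<kappa> R')\<^sup>+"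
proof
  have "push X \<kappa> R \<subseteq> push X \<kappa> ((R \<union> R')\<^sup>+)" "push X \<kappa> R' \<subseteq> push X \<kappa> ((R \<union> R')\<^sup>+)"
    by (auto intro!: push_mono)
  moreover have "E \<subseteq> (R \<union> R')\<^sup>+" using assms(2) by auto
  then have "trans (push X \<kappa> ((R \<union> R')\<^sup>+))"
    using push_equiv[OF assms(5)] by (auto simp: equiv_def)
  ultimately show "(push X \<kappa> R \<union> push X \<kappa> R')\<^sup>+ \<subseteq> push X \<kappa> ((R \<union> R')\<^sup>+)"
    by (metis Un_least trancl_id trancl_mono_subset)
  have "(\<kappa> u, \<kappa> v) \<in> (push X \<kappa> R \<union> push X \<kappa> R')\<^sup>+" if "(u, v) \<in> (R \<union> R')\<^sup>+" for u v
    using that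
  proof induction
    case (base v)
    then have "(\<kappa> u, \<kappa> v) \<in> push X \<kappa> R \<union> push X \<kappa> R'" by (auto intro: push_I)
    then show ?case by auto
  next
    case (step v w)
    then have "(\<kappa> v, \<kappa> w) \<in> push X \<kappa> R \<union> push X \<kappa> R'" by (auto intro: push_I)
    then show ?case using step by (meson trancl.trancl_into_trancl)
  qed
  moreover have "Id_on X \<subseteq> (push X \<kappa> R \<union> push X \<kappa> R')\<^sup>+" by (auto simp: push_def)
  ultimately show "push X \<kappa> ((R \<union> R')\<^sup>+) \<subseteq> (push X \<kappa> R \<union> push X \<kappa> R')\<^sup>+"
    by (auto simp: push_def[of X \<kappa> "(R \<union> R')\<^sup>+"])
qed

lemma push_eq_iff:
  assumes "equiv S R" "E \<subseteq> R" "equiv S R'" "E \<subseteq> R'"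
  shows "push X \<kappa> R = push X \<kappa> R' \<longleftrightarrow> R = R'"
proof
  have R: "R \<subseteq> S \<times> S" "R' \<subseteq> S \<times> S" using assms by (auto simp: equiv_def)
  assume "push X \<kappa> R = push X \<kappa> R'"
  then have "(u, v) \<in> R \<longleftrightarrow> (u, v) \<in> R'" if "u \<in> S" "v \<in> S" for u v
    using push_iff[OF assms(1,2) that] push_iff[OF assms(3,4) that] by simp
  then show "R = R'" using R by auto
qed simp

lemma push_ker: "push X \<kappa> E = Id_on X"
  using \<kappa> by (auto simp: push_def E)

end

section \<open>Restriction to finite traces and the representation on \<Omega>\<close>

lemma finite_separating:
  assumes "finite D" "D \<subseteq> Pow \<Omega>"
  obtains F where "F \<in> Fpow \<Omega>" "inj_on (\<lambda>S. S \<inter> F) D"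
proof -
  have "\<exists>w. w \<in> (S - T) \<union> (T - S)" if "S \<noteq> T" for S T :: "'a set" using that by auto
  then obtain w where w: "S \<noteq> T \<Longrightarrow> w S T \<in> (S - T) \<union> (T - S)" for S T :: "'a set"
    by metis
  define F where "F = (\<lambda>(S, T). w S T) ` {(S, T) \<in> D \<times> D. S \<noteq> T}"
  have "finite F" unfolding F_def
    by (intro finite_imageI, rule finite_subset[of _ "D \<times> D"]) (use assms(1) in auto)
  moreover have "F \<subseteq> \<Omega>"
  proof
    fix x assume "x \<in> F"
    then obtain S T where "S \<in> D" "T \<in> D" "S \<noteq> T" "x = w S T" by (auto simp: F_def)
    then show "x \<in> \<Omega>" using w[of S T] assms(2) by auto
  qed
  moreover have "inj_on (\<lambda>S. S \<inter> F) D"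
  proof (rule inj_onI, rule ccontr)
    fix S T assume *: "S \<in> D" "T \<in> D" "S \<inter> F = T \<inter> F" "S \<noteq> T"
    then have "w S T \<in> F" by (auto simp: F_def)
    then have "w S T \<in> S \<longleftrightarrow> w S T \<in> T" using *(3) by blast
    then show False using w[OF *(4)] by blast
  qed
  ultimately show ?thesis by (intro that[of F]) (auto simp: Fpow_def)
qed

lemma set_pt_rep: "set_pt (rep lq c u) \<subseteq> set_pt u"
  by (induction u) auto

lemma map_lterm_inverse:
  "(\<And>i. i \<in> set1_lterm p \<Longrightarrow> g (f i) = i) \<Longrightarrow> map_lterm g id (map_lterm f id p) = p"
  by (induction p) auto

lemma wf_term_set1: "wf_term I A p \<Longrightarrow> set1_lterm p \<subseteq> I"
  by (induction p) auto

lemma finite_set1_lterm: "finite (set1_lterm p)"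
  by (induction p) auto

context dense_sublattice
begin

theorem coproduct_in_Eq:
  fixes \<Omega> :: "'a set"
  assumes inf: "infinite \<Omega>" and K: "K \<lesssim> \<Omega>"
  obtains h :: "('a set, 'l) lterm \<Rightarrow> ('a \<times> 'a) set"
  where "\<And>p. wf_term (Pow \<Omega>) A p \<Longrightarrow> equiv \<Omega> (h p)"
    and "\<And>p q. wf_term (Pow \<Omega>) A p \<Longrightarrow> wf_term (Pow \<Omega>) A q \<Longrightarrow> h (TJoin p q) = (h p \<union> h q)\<^sup>+"
    and "\<And>p q. wf_term (Pow \<Omega>) A p \<Longrightarrow> wf_term (Pow \<Omega>) A q \<Longrightarrow> h (TMeet p q) = h p \<inter> h q"
    and "\<And>p q. wf_term (Pow \<Omega>) A p \<Longrightarrow> wf_term (Pow \<Omega>) A q \<Longrightarrow>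
      h p = h q \<longleftrightarrow> cop_rel (Pow \<Omega>) A inf sup {bot} p q"
    and "\<And>i. i \<in> Pow \<Omega> \<Longrightarrow> h (Gen i bot) = Id_on \<Omega>"
proof -
  define r where "r F = map_lterm (\<lambda>S. S \<inter> F) (id :: 'l \<Rightarrow> 'l)" for F :: "'a set"
  \<comment> \<open>The empty index is its own trace on every F, so one term serves as zero for all
    parts of the disjoint union.\<close>
  define z :: "('a set, 'l) lterm" where "z = Gen {} bot"
  define S where "S = (SIGMA F:Fpow \<Omega>. pts (Pow F))"
  define EV where "EV p = {((F, u), (F', v)) | F F' u v. F = F' \<and> F \<in> Fpow \<Omega> \<and> (u, v) \<in> ev (Pow F) (r F p)}" for p
  have wf_r: "wf_term (Pow F) A (r F p)" if "wf_term I A p" for F I p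
    using that by (induction p) (auto simp: r_def)
  have r_simps: "r F (TJoin p q) = TJoin (r F p) (r F q)" "r F (TMeet p q) = TMeet (r F p) (r F q)"
    "r F (Gen i x) = Gen (i \<inter> F) x" for F p q i x
    by (auto simp: r_def)
  have EV_iff: "((F, u), (F', v)) \<in> EV p \<longleftrightarrow> F = F' \<and> F \<in> Fpow \<Omega> \<and> (u, v) \<in> ev (Pow F) (r F p)"
    for F F' u v p by (auto simp: EV_def)
  have EV_equiv: "equiv S (EV p)" if "wf_term (Pow \<Omega>) A p" for p
  proof -
    have e: "equiv (pts (Pow F)) (ev (Pow F) (r F p))" for F by (intro ev_equiv wf_r[OF that])
    show ?thesis
    proof (rule equivI)
      show "EV p \<subseteq> S \<times> S" using e by (auto simp: S_def EV_def equiv_def)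
      show "refl_on S (EV p)" using e by (auto simp: S_def EV_iff equiv_def refl_on_def)
      have st: "sym (ev (Pow F) (r F p))" "trans (ev (Pow F) (r F p))" for F
        using e[of F] by (auto simp: equiv_def)
      show "sym (EV p)"
        by (rule symI) (auto simp: EV_def intro: symD[OF st(1)])
      show "trans (EV p)"
        by (rule transI) (auto simp: EV_def intro: transD[OF st(2)])
    qed
  qed
  have EV_meet: "EV (TMeet p q) = EV p \<inter> EV q" if "wf_term (Pow \<Omega>) A p" "wf_term (Pow \<Omega>) A q" for p q
    using ev_meet[OF wf_r[OF that(1)] wf_r[OF that(2)]] by (auto simp: EV_def r_simps)
  have EV_join: "EV (TJoin p q) = (EV p \<union> EV q)\<^sup>+"
    if wf: "wf_term (Pow \<Omega>) A p" "wf_term (Pow \<Omega>) A q" for p q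
  proof
    have "EV p \<union> EV q \<subseteq> EV (TJoin p q)"
      using ev_join[OF wf_r[OF wf(1)] wf_r[OF wf(2)]] by (auto simp: EV_def r_simps)
    moreover have "trans (EV (TJoin p q))" using EV_equiv[of "TJoin p q"] wf by (auto simp: equiv_def)
    ultimately show "(EV p \<union> EV q)\<^sup>+ \<subseteq> EV (TJoin p q)"
      by (metis trancl_id trancl_mono_subset)
    have "((F, u), (F, v)) \<in> (EV p \<union> EV q)\<^sup>+"
      if "(u, v) \<in> (ev (Pow F) (r F p) \<union> ev (Pow F) (r F q))\<^sup>+" "F \<in> Fpow \<Omega>" for F u v
      using that
    proof induction
      case (base v)
      then have "((F, u), (F, v)) \<in> EV p \<union> EV q" by (auto simp: EV_iff)
      then show ?case by auto
    next
      case (step v w)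
      then have "((F, v), (F, w)) \<in> EV p \<union> EV q" by (auto simp: EV_iff)
      then show ?case using step by (meson trancl.trancl_into_trancl)
    qed
    then show "EV (TJoin p q) \<subseteq> (EV p \<union> EV q)\<^sup>+"
      using ev_join[OF wf_r[OF wf(1)] wf_r[OF wf(2)]] by (auto simp: EV_def r_simps)
  qed
  have EV_eq: "EV p = EV q \<longleftrightarrow> cop_rel (Pow \<Omega>) A inf sup {bot} p q"
    if wf: "wf_term (Pow \<Omega>) A p" "wf_term (Pow \<Omega>) A q" for p q
  proof
    assume eq: "EV p = EV q"
    define D where "D = set1_lterm p \<union> set1_lterm q"
    have D: "finite D" "D \<subseteq> Pow \<Omega>"
      using wf[THEN wf_term_set1] finite_set1_lterm[of p] finite_set1_lterm[of q]
      unfolding D_def by auto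
    obtain F where F: "F \<in> Fpow \<Omega>" "inj_on (\<lambda>S. S \<inter> F) D" using D finite_separating by metis
    have "(u, v) \<in> ev (Pow F) (r F p) \<longleftrightarrow> (u, v) \<in> ev (Pow F) (r F q)" for u v
      using eq F(1) EV_iff[of F u F v p] EV_iff[of F u F v q] by auto
    then have "ev (Pow F) (r F p) = ev (Pow F) (r F q)" by auto
    then have c: "cop_rel (Pow F) A inf sup {bot} (r F p) (r F q)"
      using ev_eq_iff[OF wf_r[OF wf(1)] wf_r[OF wf(2)]] by simp
    \<comment> \<open>On the part for F no two indices of p and q are merged, so taking traces can
      be undone by g and the congruence carried back. The default value keeps g inside
      \<open>Pow \<Omega>\<close>, as \<open>cop_rel_map\<close> demands.\<close>
    define g where "g T = (if T \<in> (\<lambda>S. S \<inter> F) ` D then the_inv_into D (\<lambda>S. S \<inter> F) T else {})" for T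
    have g: "g (S \<inter> F) = S" if "S \<in> D" for S
      using the_inv_into_f_f[OF F(2) that] that by (simp add: g_def)
    have gD: "g T \<in> Pow \<Omega>" for T
    proof (cases "T \<in> (\<lambda>S. S \<inter> F) ` D")
      case True
      then obtain S where "S \<in> D" "T = S \<inter> F" by auto
      then show ?thesis using g D(2) by auto
    next
      case False
      then show ?thesis by (simp only: g_def if_False) simp
    qed
    have "cop_rel (Pow \<Omega>) A inf sup {bot} (map_lterm g id (r F p)) (map_lterm g id (r F q))"
      by (rule cop_rel_map[OF c]) (use gD in auto)
    moreover have "map_lterm g id (r F p) = p" "map_lterm g id (r F q) = q"
      unfolding r_def using g by (auto intro!: map_lterm_inverse simp: D_def)
    ultimately show "cop_rel (Pow \<Omega>) A inf sup {bot} p q" by simp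
  next
    assume c: "cop_rel (Pow \<Omega>) A inf sup {bot} p q"
    have "cop_rel (Pow F) A inf sup {bot} (r F p) (r F q)" for F
      unfolding r_def by (rule cop_rel_map[OF c]) auto
    then have "ev (Pow F) (r F p) = ev (Pow F) (r F q)" for F
      using ev_eq_iff[OF wf_r[OF wf(1)] wf_r[OF wf(2)]] by simp
    then show "EV p = EV q" by (simp add: EV_def)
  qed
  \<comment> \<open>One label set for all F: every subset of a finite F lies in
    \<open>Fpow \<Omega>\<close>, an index set that injects into \<Omega>.\<close>
  let ?P = "{u. set_pt u \<subseteq> Collect (wf_term (Fpow \<Omega>) K)}"
  have "Fpow \<Omega> \<times> ?P \<lesssim> \<Omega> \<times> \<Omega>"
    by (intro times_lepoll_mono Fpow_lepoll_infinite pts_lepoll_infinite terms_lepoll_infinite inf K)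
  also have "\<Omega> \<times> \<Omega> \<lesssim> \<Omega>" using inf by (rule infinite_times_lepoll)
  finally obtain c where c: "inj_on c (Fpow \<Omega> \<times> ?P)" "c ` (Fpow \<Omega> \<times> ?P) \<subseteq> \<Omega>"
    unfolding lepoll_def by auto
  \<comment> \<open>Replacing u by its representative at zero before coding gives \<kappa> exactly
    the kernel \<open>EV z\<close>. Dividing by the relation of zero and injecting into \<Omega>
    thus happen in one map, and zero is sent to the identity.\<close>
  define \<kappa> where "\<kappa> = (\<lambda>(F, u). c (F, rep (term_le (Pow F)) z u))"
  have P: "rep (term_le (Pow F)) z u \<in> ?P" if "F \<in> Fpow \<Omega>" "u \<in> pts (Pow F)" for F u
  proof -
    have "set_pt (rep (term_le (Pow F)) z u) \<subseteq> set_pt u" by (rule set_pt_rep)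
    also have "\<dots> \<subseteq> Collect (wf_term (Pow F) K)" using that by (intro set_pts)
    also have "\<dots> \<subseteq> Collect (wf_term (Fpow \<Omega>) K)"
      using that by (auto intro: finite_subset elim!: wf_term_mono simp: Fpow_def)
    finally show ?thesis by simp
  qed
  have \<kappa>: "\<kappa> ` S \<subseteq> \<Omega>" using c P by (auto simp: \<kappa>_def S_def)
  have E: "EV z = {(x, y). x \<in> S \<and> y \<in> S \<and> \<kappa> x = \<kappa> y}"
  proof -
    have "(x, y) \<in> EV z \<longleftrightarrow> x \<in> S \<and> y \<in> S \<and> \<kappa> x = \<kappa> y" for x y
    proof (cases x; cases y)
      fix F u G v assume xy: "x = (F, u)" "y = (G, v)"
      have "\<kappa> x = \<kappa> y \<longleftrightarrow> F = G \<and> rep (term_le (Pow F)) z u = rep (term_le (Pow F)) z v" if "x \<in> S" "y \<in> S"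
        using inj_on_eq_iff[OF c(1), of "(F, rep (term_le (Pow F)) z u)" "(G, rep (term_le (Pow G)) z v)"]
          that P unfolding xy \<kappa>_def S_def by auto
      moreover have "r F z = Gen {} bot" by (simp add: z_def r_simps)
      ultimately show ?thesis
        unfolding xy EV_iff using ev_bot[of "{}" "Pow F"] by (auto simp: S_def z_def)
    qed
    then show ?thesis by auto
  qed
  have least: "EV z \<subseteq> EV p" if "wf_term (Pow \<Omega>) A p" for p
  proof -
    have "ev (Pow F) (r F z) \<subseteq> ev (Pow F) (r F p)" for F
      using ev_bot_least[of "{}" "Pow F" "r F p"] wf_r[OF that] by (simp add: z_def r_simps)
    then show ?thesis unfolding EV_def by blast
  qed
  show ?thesis
  proof (rule that[of "\<lambda>p. push \<Omega> \<kappa> (EV p)"])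
    fix p q assume wf: "wf_term (Pow \<Omega>) A p" "wf_term (Pow \<Omega>) A q"
    note pq = EV_equiv[OF wf(1)] least[OF wf(1)] EV_equiv[OF wf(2)] least[OF wf(2)]
    show "push \<Omega> \<kappa> (EV (TJoin p q)) = (push \<Omega> \<kappa> (EV p) \<union> push \<Omega> \<kappa> (EV q))\<^sup>+"
      using push_trancl[OF \<kappa> E pq] EV_equiv[of "TJoin p q"] wf by (simp add: EV_join)
    show "push \<Omega> \<kappa> (EV (TMeet p q)) = push \<Omega> \<kappa> (EV p) \<inter> push \<Omega> \<kappa> (EV q)"
      using push_Int[OF \<kappa> E pq] wf by (simp add: EV_meet)
    show "push \<Omega> \<kappa> (EV p) = push \<Omega> \<kappa> (EV q) \<longleftrightarrow> cop_rel (Pow \<Omega>) A inf sup {bot} p q"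
      using push_eq_iff[OF \<kappa> E pq] EV_eq[OF wf] by simp
  next
    fix p assume wf: "wf_term (Pow \<Omega>) A p"
    show "equiv \<Omega> (push \<Omega> \<kappa> (EV p))" using push_equiv[OF \<kappa> E EV_equiv[OF wf] least[OF wf]] .
  next
    fix i assume "i \<in> Pow \<Omega>"
    then have "EV (Gen i bot) = EV z" unfolding z_def
      using EV_eq[of "Gen i bot" "Gen {} bot"] bot_A by (auto intro: gen_ident)
    then show "push \<Omega> \<kappa> (EV (Gen i bot)) = Id_on \<Omega>" using push_ker[OF \<kappa> E] by simp
  qed
qed

end

section \<open>Adjoining a zero, duality, and maps on congruence classes\<close>

text \<open>The reduction for coproducts without amalgamated zero: the old zeros become nonzero
  elements \<open>Some bot\<close>, so identifying \<open>None\<close> across the copies imposes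
  nothing on them.\<close>

lemma dense_sublattice_option:
  assumes "dense_sublattice A K"
  shows "dense_sublattice (insert None (Some ` A)) (insert None (Some ` K))"
proof -
  interpret dense_sublattice A K by (rule assms)
  show ?thesis
  proof
    fix x y assume x: "x \<in> insert None (Some ` A)" and y: "y \<in> insert None (Some ` A)"
      and le: "\<And>k. k \<in> insert None (Some ` K) \<Longrightarrow> k \<le> x \<Longrightarrow> k \<le> y"
    show "x \<le> y"
    proof (cases x)
      case (Some a)
      then have "a \<in> A" using x by auto
      \<comment> \<open>The old zero is compact and lies below \<open>Some a\<close>, which excludes
        \<open>None\<close> as the value of y.\<close>
      have "Some bot \<le> y" using le[of "Some bot"] bot_K Some by auto
      then obtain b where b: "y = Some b" by (cases y) auto
      have "k \<le> b" if "k \<in> K" "k \<le> a" for k using le[of "Some k"] that Some b by auto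
      then show ?thesis using dense[of a b] x y Some b by auto
    qed auto
  next
    fix k x y assume k: "k \<in> insert None (Some ` K)" and x: "x \<in> insert None (Some ` A)"
      and y: "y \<in> insert None (Some ` A)" and le: "k \<le> sup x y"
    show "\<exists>k1\<in>insert None (Some ` K). \<exists>k2\<in>insert None (Some ` K). k1 \<le> x \<and> k2 \<le> y \<and> k \<le> sup k1 k2"
    proof (cases "\<exists>a b c. x = Some a \<and> y = Some b \<and> k = Some c")
      case True
      then obtain a b c where abc: "x = Some a" "y = Some b" "k = Some c" by auto
      then obtain k1 k2 where "k1 \<in> K" "k2 \<in> K" "k1 \<le> a" "k2 \<le> b" "c \<le> sup k1 k2"
        using compact[of c a b] k x y le by auto
      then show ?thesis using abc by (intro bexI[of _ "Some k1"] bexI[of _ "Some k2"]) auto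
    next
      case False
      then consider "k = None" | "x = None" | "y = None" by (cases k; cases x; cases y) auto
      then show ?thesis
      proof cases
        case 1
        then show ?thesis by (intro bexI[of _ None]) auto
      next
        case 2
        then show ?thesis using k le by (intro bexI[of _ None] bexI[of _ k]) auto
      next
        case 3
        then show ?thesis using k le by (intro bexI[of _ k] bexI[of _ None]) auto
      qed
    qed
  qed (use K_A sup_A inf_A sup_K inf_K in \<open>auto simp: bot_option_def\<close>)
qed

text \<open>Removes the adjoined zero \<^term>\<open>None\<close> from a term; the result is \<^term>\<open>None\<close> if the term is zero.\<close>

fun strip :: "('i, 'b option) lterm \<Rightarrow> ('i, 'b) lterm option" where
  "strip (Gen i x) = map_option (Gen i) x"
| "strip (TJoin p q) = (case strip p of None \<Rightarrow> strip q
    | Some a \<Rightarrow> Some (case strip q of None \<Rightarrow> a | Some b \<Rightarrow> TJoin a b))"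
| "strip (TMeet p q) = Option.bind (strip p) (\<lambda>a. map_option (TMeet a) (strip q))"

lemma wf_strip:
  "wf_term I (insert None (Some ` A)) p \<Longrightarrow> strip p = Some a \<Longrightarrow> wf_term I A a"
proof (induction p arbitrary: a)
  case (TJoin p q)
  then show ?case by (cases "strip p"; cases "strip q") auto
qed (auto simp: bind_eq_Some_conv)

lemma strip_map_Some: "strip (map_lterm id Some p) = Some p"
  by (induction p) auto

text \<open>Deleting the new zero undoes the inclusion by \<open>Some\<close>, so this gives
  injectivity of the inclusion on classes. Where a subterm disappears, the lattice axioms degenerate
  to reflexivity, or for \<open>meet_absorb\<close> to idempotence of the meet.\<close>

lemma cop_rel_strip:
  fixes A :: "'b::lattice set"
  assumes "cop_rel I (insert None (Some ` A)) inf sup {bot} p q"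
  shows "rel_option (cop_rel I A inf sup {}) (strip p) (strip q)"
proof -
  let ?R = "cop_rel I A inf sup {}"
  have meet_idem: "?R (TMeet p p) p" if "wf_term I A p" for p
    using cl_refl[OF that] cl_meet_iff[OF that that] by simp
  note wf = wf_strip[of I A]
  show ?thesis
    using assms
  proof induction
    case (crefl p)
    then show ?case using wf[of p] by (cases "strip p") (auto intro: cop_rel.crefl)
  next
    case (csym p q)
    from csym.IH show ?case by (cases "strip p"; cases "strip q") (auto intro: cop_rel.csym)
  next
    case (ctrans p q r)
    from ctrans.IH show ?case
      by (cases "strip p"; cases "strip q"; cases "strip r") (auto intro: cop_rel.ctrans)
  next
    case (cjoin p p' q q')
    from cjoin.IH show ?case
      by (cases "strip p"; cases "strip p'"; cases "strip q"; cases "strip q'") (auto intro: cop_rel.cjoin)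
  next
    case (cmeet p p' q q')
    from cmeet.IH show ?case
      by (cases "strip p"; cases "strip p'"; cases "strip q"; cases "strip q'") (auto intro: cop_rel.cmeet)
  next
    case (join_comm p q)
    then show ?case using wf[of p] wf[of q]
      by (cases "strip p"; cases "strip q") (auto intro: cop_rel.join_comm cop_rel.crefl)
  next
    case (meet_comm p q)
    then show ?case using wf[of p] wf[of q]
      by (cases "strip p"; cases "strip q") (auto intro: cop_rel.meet_comm)
  next
    case (join_assoc p q r)
    then show ?case using wf[of p] wf[of q] wf[of r]
      by (cases "strip p"; cases "strip q"; cases "strip r") (auto intro: cop_rel.join_assoc cop_rel.crefl)
  next
    case (meet_assoc p q r)
    then show ?case using wf[of p] wf[of q] wf[of r]
      by (cases "strip p"; cases "strip q"; cases "strip r") (auto intro: cop_rel.meet_assoc)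
  next
    case (join_absorb p q)
    then show ?case using wf[of p] wf[of q]
      by (cases "strip p"; cases "strip q") (auto intro: cop_rel.join_absorb cop_rel.crefl)
  next
    case (meet_absorb p q)
    then show ?case using wf[of p] wf[of q]
      by (cases "strip p"; cases "strip q") (auto intro: cop_rel.meet_absorb meet_idem)
  next
    case (gen_join i x y)
    then show ?case
      by (cases x; cases y) (auto intro: cop_rel.gen_join cop_rel.crefl)
  next
    case (gen_meet i x y)
    then show ?case
      by (cases x; cases y) (auto intro: cop_rel.gen_meet)
  next
    case (gen_ident i j z)
    then show ?case by (auto simp: bot_option_def)
  qed
qed

fun dual :: "('i, 'b) lterm \<Rightarrow> ('i, 'b) lterm" where
  "dual (Gen i x) = Gen i x"
| "dual (TJoin p q) = TMeet (dual p) (dual q)"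
| "dual (TMeet p q) = TJoin (dual p) (dual q)"

lemma dual_dual: "dual (dual p) = p"
  by (induction p) auto

lemma wf_dual: "wf_term I A (dual p) \<longleftrightarrow> wf_term I A p"
  by (induction p) auto

text \<open>The axioms are symmetric in join and meet. The set Z stays the same because the zero of
  Eq \<Omega> is the unit of its dual.\<close>

lemma cop_rel_dual:
  "cop_rel I A mt jn Z p q \<Longrightarrow> cop_rel I A jn mt Z (dual p) (dual q)"
proof (induction rule: cop_rel.induct)
  case (csym p q)
  from csym.IH show ?case by (rule cop_rel.csym)
next
  case (ctrans p q r)
  from ctrans.IH show ?case by (rule cop_rel.ctrans)
qed (auto simp: wf_dual intro: cop_rel.intros)

lemma cop_rel_dual_iff:
  "cop_rel I A jn mt Z (dual p) (dual q) \<longleftrightarrow> cop_rel I A mt jn Z p q"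
  using cop_rel_dual[of I A mt jn Z p q] cop_rel_dual[of I A jn mt Z "dual p" "dual q"]
  by (auto simp: dual_dual)

text \<open>The choice is harmless for the maps used below, whose kernel is the congruence.\<close>

definition on_classes :: "(('i, 'b) lterm \<Rightarrow> 'c) \<Rightarrow> ('i, 'b) lterm set \<Rightarrow> 'c" where
  "on_classes h c = h (SOME p. p \<in> c)"

lemma on_classes:
  assumes closed: "\<And>x y. x \<in> A \<Longrightarrow> y \<in> A \<Longrightarrow> mt x y \<in> A" "\<And>x y. x \<in> A \<Longrightarrow> y \<in> A \<Longrightarrow> jn x y \<in> A"
    and eq: "\<And>p q. wf_term I A p \<Longrightarrow> wf_term I A q \<Longrightarrow> h p = h q \<longleftrightarrow> cop_rel I A mt jn Z p q"
    and p: "wf_term I A p"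
  shows "on_classes h (cop_class I A mt jn Z p) = h p"
proof -
  have "p \<in> cop_class I A mt jn Z p" using p by (auto simp: cop_class_def intro: crefl)
  then have "(SOME q. q \<in> cop_class I A mt jn Z p) \<in> cop_class I A mt jn Z p" by (rule someI)
  then have r: "cop_rel I A mt jn Z p (SOME q. q \<in> cop_class I A mt jn Z p)"
    by (simp add: cop_class_def)
  then have "wf_term I A (SOME q. q \<in> cop_class I A mt jn Z p)"
    using cop_rel_wf[OF r closed] by auto
  then show ?thesis using eq[OF p] r unfolding on_classes_def by metis
qed

lemma cop_embedding_on_classes:
  assumes closed: "\<And>x y. x \<in> A \<Longrightarrow> y \<in> A \<Longrightarrow> mt x y \<in> A" "\<And>x y. x \<in> A \<Longrightarrow> y \<in> A \<Longrightarrow> jn x y \<in> A"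
    and eq: "\<And>p q. wf_term I A p \<Longrightarrow> wf_term I A q \<Longrightarrow> h p = h q \<longleftrightarrow> cop_rel I A mt jn Z p q"
    and B: "\<And>p. wf_term I A p \<Longrightarrow> h p \<in> B"
    and jn: "\<And>p q. wf_term I A p \<Longrightarrow> wf_term I A q \<Longrightarrow> h (TJoin p q) = jnB (h p) (h q)"
    and mt: "\<And>p q. wf_term I A p \<Longrightarrow> wf_term I A q \<Longrightarrow> h (TMeet p q) = mtB (h p) (h q)"
  shows "cop_embedding I A mt jn Z B mtB jnB (on_classes h)"
proof -
  note oc = on_classes[OF closed eq]
  have "cop_class I A mt jn Z p = cop_class I A mt jn Z q" if "cop_rel I A mt jn Z p q" for p q
    using that unfolding cop_class_def by (blast intro: csym ctrans)
  then show ?thesis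
    unfolding cop_embedding_def cop_carrier_def inj_on_def using eq B by (auto simp: oc jn mt)
qed

text \<open>The recursion for covers needs a type of class \<open>bounded_lattice_bot\<close>, hence
  equivalences on a whole type.\<close>

typedef 'a eqv = "{R :: ('a \<times> 'a) set. equiv UNIV R}"
  morphisms eqv_rel Eqv
  by (rule exI[of _ UNIV]) (auto simp: equiv_def refl_on_def sym_def trans_def)

lemma equiv_eqv_rel: "equiv UNIV (eqv_rel x)"
  using eqv_rel by auto

lemma eqv_rel_props: "refl (eqv_rel x)" "sym (eqv_rel x)" "trans (eqv_rel x)"
  using equiv_eqv_rel[of x] by (auto simp: equiv_def)

lemma Id_subset_eqv_rel: "Id \<subseteq> eqv_rel x"
  using eqv_rel_props(1)[of x] by (auto simp: refl_on_def)

lemma eqv_rel_Eqv: "equiv UNIV R \<Longrightarrow> eqv_rel (Eqv R) = R"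
  by (simp add: Eqv_inverse)

lemma equiv_trancl_Un:
  assumes "equiv X R" "equiv X S"
  shows "equiv X ((R \<union> S)\<^sup>+)"
proof (rule equivI)
  have RS: "R \<subseteq> X \<times> X" "S \<subseteq> X \<times> X" "sym R" "sym S" "refl_on X R" using assms by (auto simp: equiv_def)
  then show "(R \<union> S)\<^sup>+ \<subseteq> X \<times> X" by (intro trancl_subset_Sigma) auto
  show "refl_on X ((R \<union> S)\<^sup>+)" using RS(5) by (auto simp: refl_on_def)
  show "sym ((R \<union> S)\<^sup>+)" using RS by (intro sym_trancl sym_Un)
  show "trans ((R \<union> S)\<^sup>+)" by (rule trans_trancl)
qed

lemma equiv_Int: "equiv X R \<Longrightarrow> equiv X S \<Longrightarrow> equiv X (R \<inter> S)"
  by (auto simp: equiv_def refl_on_def intro: sym_Int trans_Int)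

instantiation eqv :: (type) bounded_lattice_bot
begin

definition "x \<le> y \<longleftrightarrow> eqv_rel x \<subseteq> eqv_rel y"
definition "x < y \<longleftrightarrow> eqv_rel x \<subset> eqv_rel y"
definition "inf x y = Eqv (eqv_rel x \<inter> eqv_rel y)"
definition "sup x y = Eqv ((eqv_rel x \<union> eqv_rel y)\<^sup>+)"
definition "bot = Eqv Id"

lemma eqv_rel_inf: "eqv_rel (inf x y) = eqv_rel x \<inter> eqv_rel y"
  unfolding inf_eqv_def by (intro eqv_rel_Eqv equiv_Int equiv_eqv_rel)

lemma eqv_rel_sup: "eqv_rel (sup x y) = (eqv_rel x \<union> eqv_rel y)\<^sup>+"
  unfolding sup_eqv_def by (intro eqv_rel_Eqv equiv_trancl_Un equiv_eqv_rel)

lemma eqv_rel_bot: "eqv_rel bot = Id"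
  unfolding bot_eqv_def by (rule eqv_rel_Eqv) (auto simp: equiv_def refl_on_def sym_def trans_def)

instance
proof
  fix x y z :: "'a eqv"
  show "sup y z \<le> x" if "y \<le> x" "z \<le> x"
  proof -
    have "(eqv_rel y \<union> eqv_rel z)\<^sup>+ \<subseteq> (eqv_rel x)\<^sup>+"
      using that by (intro trancl_mono_subset) (auto simp: less_eq_eqv_def)
    then show ?thesis by (simp add: less_eq_eqv_def eqv_rel_sup eqv_rel_props)
  qed
  show "bot \<le> x" using eqv_rel_props(1)[of x]
    by (auto simp: less_eq_eqv_def eqv_rel_bot refl_on_def)
qed (auto simp: less_eq_eqv_def less_eqv_def eqv_rel_inf eqv_rel_sup eqv_rel_inject)

end

section \<open>Equivalence relations as a lattice type\<close>

text \<open>The lattice Eq of a subset of a type becomes a principal ideal of Eq of the whole type.\<close>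

definition eqv_on :: "'a set \<Rightarrow> 'a eqv set" where
  "eqv_on \<Omega> = {x. eqv_rel x \<subseteq> Id \<union> \<Omega> \<times> \<Omega>}"

text \<open>These are the compact elements, that is, the finitely generated equivalences.\<close>

definition fin_eqv_on :: "'a set \<Rightarrow> 'a eqv set" where
  "fin_eqv_on \<Omega> = {x \<in> eqv_on \<Omega>. finite (eqv_rel x - Id)}"

text \<open>Turns membership of a pair into an inequality; for equal arguments it is
  \<open>bot\<close>.\<close>

definition atom :: "'a \<Rightarrow> 'a \<Rightarrow> 'a eqv" where
  "atom a b = Eqv (Id \<union> {(a, b), (b, a)})"

lemma eqv_rel_atom: "eqv_rel (atom a b) = Id \<union> {(a, b), (b, a)}"
  unfolding atom_def
  by (rule eqv_rel_Eqv) (auto simp: equiv_def refl_on_def sym_def trans_def)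

lemma atom_le_iff: "atom a b \<le> x \<longleftrightarrow> (a, b) \<in> eqv_rel x"
  using eqv_rel_props[of x] by (auto simp: less_eq_eqv_def eqv_rel_atom refl_on_def dest: symD)

lemma atom_in:
  assumes "(a, b) \<in> eqv_rel x" "x \<in> eqv_on \<Omega>"
  shows "atom a b \<in> fin_eqv_on \<Omega>"
proof -
  have "finite (eqv_rel (atom a b) - Id)"
    by (rule finite_subset[of _ "{(a, b), (b, a)}"]) (auto simp: eqv_rel_atom)
  moreover have "(b, a) \<in> eqv_rel x" using assms(1) by (rule symD[OF eqv_rel_props(2)])
  ultimately show ?thesis using assms by (auto simp: fin_eqv_on_def eqv_on_def eqv_rel_atom)
qed

lemma trancl_Id_Un_square: "R \<subseteq> Id \<union> F \<times> F \<Longrightarrow> R\<^sup>+ \<subseteq> Id \<union> F \<times> F"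
proof -
  assume R: "R \<subseteq> Id \<union> F \<times> F"
  have "trans (Id \<union> F \<times> F)" by (auto simp: trans_def)
  then show ?thesis using trancl_mono_subset[OF R] by simp
qed

text \<open>A pair in the join is connected by a finite path. Each step contributes an atom below x
  or below y, which is joined to k1 or to k2.\<close>

lemma eqv_join_compact:
  assumes "(a, b) \<in> eqv_rel (sup x y)" "x \<in> eqv_on \<Omega>" "y \<in> eqv_on \<Omega>"
    and sup_K: "\<And>u v. u \<in> fin_eqv_on \<Omega> \<Longrightarrow> v \<in> fin_eqv_on \<Omega> \<Longrightarrow> sup u v \<in> fin_eqv_on \<Omega>"
    and bot_K: "bot \<in> fin_eqv_on \<Omega>"
  shows "\<exists>k1\<in>fin_eqv_on \<Omega>. \<exists>k2\<in>fin_eqv_on \<Omega>. k1 \<le> x \<and> k2 \<le> y \<and> atom a b \<le> sup k1 k2"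
  using assms(1) unfolding eqv_rel_sup
proof (induction rule: trancl_induct)
  case (base b)
  then show ?case
  proof
    assume "(a, b) \<in> eqv_rel x"
    then show ?thesis using assms(2) bot_K
      by (intro bexI[of _ "atom a b"] bexI[of _ bot]) (auto simp: atom_le_iff eqv_rel_atom intro: atom_in)
  next
    assume "(a, b) \<in> eqv_rel y"
    then show ?thesis using assms(3) bot_K
      by (intro bexI[of _ bot] bexI[of _ "atom a b"]) (auto simp: atom_le_iff eqv_rel_atom intro: atom_in)
  qed
next
  case (step b c)
  then obtain k1 k2 where k: "k1 \<in> fin_eqv_on \<Omega>" "k2 \<in> fin_eqv_on \<Omega>" "k1 \<le> x" "k2 \<le> y"
    "atom a b \<le> sup k1 k2" by auto
  have trans: "atom a c \<le> z" if "atom a b \<le> z" "atom b c \<le> z" for z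
    using that eqv_rel_props(3)[of z] by (auto simp: atom_le_iff dest: transD)
  from step(2) show ?case
  proof
    assume bc: "(b, c) \<in> eqv_rel x"
    have "atom a c \<le> sup (sup k1 (atom b c)) k2"
    proof (rule trans)
      have "sup k1 k2 \<le> sup (sup k1 (atom b c)) k2" by (intro sup_mono) auto
      then show "atom a b \<le> sup (sup k1 (atom b c)) k2" using k(5) by (rule order_trans[rotated])
    qed (simp add: le_supI1)
    then show ?thesis using k bc assms(2)
      by (intro bexI[of _ "sup k1 (atom b c)"] bexI[of _ k2]) (auto simp: atom_le_iff intro!: sup_K atom_in)
  next
    assume bc: "(b, c) \<in> eqv_rel y"
    have "atom a c \<le> sup k1 (sup k2 (atom b c))"
    proof (rule trans)
      have "sup k1 k2 \<le> sup k1 (sup k2 (atom b c))" by (intro sup_mono) auto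
      then show "atom a b \<le> sup k1 (sup k2 (atom b c))" using k(5) by (rule order_trans[rotated])
    qed (simp add: le_supI2)
    then show ?thesis using k bc assms(3)
      by (intro bexI[of _ k1] bexI[of _ "sup k2 (atom b c)"]) (auto simp: atom_le_iff intro!: sup_K atom_in)
  qed
qed

lemma dense_sublattice_eqv: "dense_sublattice (eqv_on \<Omega>) (fin_eqv_on \<Omega>)"
proof -
  have sup_A: "sup x y \<in> eqv_on \<Omega>" if "x \<in> eqv_on \<Omega>" "y \<in> eqv_on \<Omega>" for x y
    using that trancl_Id_Un_square[of "eqv_rel x \<union> eqv_rel y" \<Omega>] by (simp add: eqv_on_def eqv_rel_sup)
  have inf_A: "inf x y \<in> eqv_on \<Omega>" if "x \<in> eqv_on \<Omega>" for x y
    using that by (auto simp: eqv_on_def eqv_rel_inf)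
  have inf_K: "inf x y \<in> fin_eqv_on \<Omega>" if "x \<in> fin_eqv_on \<Omega>" for x y
  proof -
    have "finite (eqv_rel (inf x y) - Id)"
      by (rule finite_subset[of _ "eqv_rel x - Id"]) (use that in \<open>auto simp: fin_eqv_on_def eqv_rel_inf\<close>)
    then show ?thesis using that inf_A[of x y] by (simp add: fin_eqv_on_def)
  qed
  have K_A: "fin_eqv_on \<Omega> \<subseteq> eqv_on \<Omega>" by (auto simp: fin_eqv_on_def)
  have bot_K: "bot \<in> fin_eqv_on \<Omega>" by (auto simp: fin_eqv_on_def eqv_on_def eqv_rel_bot)
  have sup_K: "sup x y \<in> fin_eqv_on \<Omega>" if xy: "x \<in> fin_eqv_on \<Omega>" "y \<in> fin_eqv_on \<Omega>" for x y
  proof -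
    let ?D = "(eqv_rel x - Id) \<union> (eqv_rel y - Id)"
    let ?F = "Field ?D"
    \<comment> \<open>Outside the identity everything happens on a finite set of points, and the
      transitive closure cannot leave its square.\<close>
    have "eqv_rel x \<union> eqv_rel y \<subseteq> Id \<union> ?F \<times> ?F" by (auto intro: FieldI1 FieldI2)
    then have "(eqv_rel x \<union> eqv_rel y)\<^sup>+ - Id \<subseteq> ?F \<times> ?F" using trancl_Id_Un_square by blast
    moreover have "finite (?F \<times> ?F)"
      using xy by (intro finite_cartesian_product finite_Field) (auto simp: fin_eqv_on_def)
    ultimately show ?thesis using sup_A[of x y] xy
      by (auto simp: fin_eqv_on_def eqv_rel_sup intro: finite_subset)
  qed
  show ?thesis
  proof
    fix x y :: "'a eqv" assume x: "x \<in> eqv_on \<Omega>" and le: "\<And>k. k \<in> fin_eqv_on \<Omega> \<Longrightarrow> k \<le> x \<Longrightarrow> k \<le> y"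
    have "(a, b) \<in> eqv_rel y" if "(a, b) \<in> eqv_rel x" for a b
      using le[OF atom_in[OF that x]] that by (simp add: atom_le_iff)
    then show "x \<le> y" by (auto simp: less_eq_eqv_def)
  next
    fix k x y assume k: "k \<in> fin_eqv_on \<Omega>" and x: "x \<in> eqv_on \<Omega>" and y: "y \<in> eqv_on \<Omega>"
      and le: "k \<le> sup x y"
    \<comment> \<open>The finitely many nontrivial pairs of k are treated one at a time, and the
      compact elements found for them are joined.\<close>
    have "finite D \<Longrightarrow> D \<subseteq> eqv_rel k \<Longrightarrow>
      \<exists>k1\<in>fin_eqv_on \<Omega>. \<exists>k2\<in>fin_eqv_on \<Omega>. k1 \<le> x \<and> k2 \<le> y \<and> D \<subseteq> eqv_rel (sup k1 k2)" for D
    proof (induction rule: finite_induct)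
      case empty
      then show ?case using bot_K by (intro bexI[of _ bot]) auto
    next
      case (insert d D)
      obtain a b where d: "d = (a, b)" by (cases d)
      have "(a, b) \<in> eqv_rel (sup x y)" using insert.prems le d by (auto simp: less_eq_eqv_def)
      from eqv_join_compact[OF this x y sup_K bot_K]
      obtain m1 m2 where m: "m1 \<in> fin_eqv_on \<Omega>" "m2 \<in> fin_eqv_on \<Omega>" "m1 \<le> x" "m2 \<le> y"
        "atom a b \<le> sup m1 m2"
        by blast
      obtain k1 k2 where kk: "k1 \<in> fin_eqv_on \<Omega>" "k2 \<in> fin_eqv_on \<Omega>" "k1 \<le> x" "k2 \<le> y"
        "D \<subseteq> eqv_rel (sup k1 k2)"
        using insert.IH insert.prems by auto
      let ?s = "sup (sup k1 m1) (sup k2 m2)"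
      have "sup k1 k2 \<le> ?s" "sup m1 m2 \<le> ?s" by (auto intro: le_supI1 le_supI2)
      then have "D \<subseteq> eqv_rel ?s" "atom a b \<le> ?s"
        using kk(5) m(5) unfolding less_eq_eqv_def by blast+
      then have "insert d D \<subseteq> eqv_rel ?s" using d by (simp add: atom_le_iff)
      moreover have "sup k1 m1 \<in> fin_eqv_on \<Omega>" "sup k2 m2 \<in> fin_eqv_on \<Omega>"
        using kk m by (blast intro: sup_K)+
      moreover have "sup k1 m1 \<le> x" "sup k2 m2 \<le> y" using kk m by (simp_all add: le_supI)
      ultimately show ?case by blast
    qed
    from this[of "eqv_rel k - Id"] obtain k1 k2 where kk: "k1 \<in> fin_eqv_on \<Omega>" "k2 \<in> fin_eqv_on \<Omega>"
      "k1 \<le> x" "k2 \<le> y" "eqv_rel k - Id \<subseteq> eqv_rel (sup k1 k2)"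
      using k by (auto simp: fin_eqv_on_def)
    then have "k \<le> sup k1 k2" using Id_subset_eqv_rel[of "sup k1 k2"] by (auto simp: less_eq_eqv_def)
    then show "\<exists>k1\<in>fin_eqv_on \<Omega>. \<exists>k2\<in>fin_eqv_on \<Omega>. k1 \<le> x \<and> k2 \<le> y \<and> k \<le> sup k1 k2"
      using kk by auto
  qed (rule sup_A inf_A K_A bot_K sup_K inf_K; assumption)+
qed

lemma fin_eqv_on_lepoll:
  assumes "infinite \<Omega>"
  shows "fin_eqv_on \<Omega> \<lesssim> \<Omega>"
proof -
  have "inj_on (\<lambda>x. eqv_rel x - Id) (fin_eqv_on \<Omega>)"
  proof (rule inj_onI)
    fix x y :: "'a eqv" assume "eqv_rel x - Id = eqv_rel y - Id"
    moreover note Id_subset_eqv_rel[of x] Id_subset_eqv_rel[of y]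
    ultimately have "eqv_rel x = eqv_rel y" by blast
    then show "x = y" by (simp add: eqv_rel_inject)
  qed
  moreover have "(\<lambda>x. eqv_rel x - Id) ` fin_eqv_on \<Omega> \<subseteq> Fpow (\<Omega> \<times> \<Omega>)"
    by (auto simp: fin_eqv_on_def eqv_on_def Fpow_def)
  ultimately have "fin_eqv_on \<Omega> \<lesssim> Fpow (\<Omega> \<times> \<Omega>)" unfolding lepoll_def by blast
  also have "\<dots> \<lesssim> \<Omega> \<times> \<Omega>" using assms by (intro Fpow_lepoll_infinite) (auto simp: finite_cartesian_product_iff)
  also have "\<dots> \<lesssim> \<Omega>" using assms by (rule infinite_times_lepoll)
  finally show ?thesis .
qed

section \<open>The isomorphism between Eq of a set and the ideal \<open>eqv_on\<close>\<close>

definition to_eqv :: "('a \<times> 'a) set \<Rightarrow> 'a eqv" where "to_eqv R = Eqv (R \<union> Id)"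

definition of_eqv :: "'a set \<Rightarrow> 'a eqv \<Rightarrow> ('a \<times> 'a) set" where
  "of_eqv \<Omega> x = eqv_rel x \<inter> \<Omega> \<times> \<Omega>"

lemma EqL_iff: "R \<in> EqL \<Omega> \<longleftrightarrow> equiv \<Omega> R"
  by (simp add: EqL_def)

lemma eq_meet_EqL: "R \<in> EqL \<Omega> \<Longrightarrow> S \<in> EqL \<Omega> \<Longrightarrow> eq_meet R S \<in> EqL \<Omega>"
  by (simp add: EqL_iff eq_meet_def equiv_Int)

lemma eq_join_EqL: "R \<in> EqL \<Omega> \<Longrightarrow> S \<in> EqL \<Omega> \<Longrightarrow> eq_join R S \<in> EqL \<Omega>"
  by (simp add: EqL_iff eq_join_def equiv_trancl_Un)

context
  fixes \<Omega> :: "'a set"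
begin

lemma EqL_subset: "R \<in> EqL \<Omega> \<Longrightarrow> Id_on \<Omega> \<subseteq> R \<and> R \<subseteq> \<Omega> \<times> \<Omega>"
  by (auto simp: EqL_iff equiv_def refl_on_def)

lemma eqv_rel_to_eqv:
  assumes "R \<in> EqL \<Omega>"
  shows "eqv_rel (to_eqv R) = R \<union> Id"
  unfolding to_eqv_def
proof (rule eqv_rel_Eqv, rule equivI)
  have R: "sym R" "trans R" using assms by (auto simp: EqL_iff equiv_def)
  show "sym (R \<union> Id)" using R(1) by (intro sym_Un sym_Id)
  show "trans (R \<union> Id)" by (rule transI) (auto intro: transD[OF R(2)])
qed (auto simp: refl_on_def)

lemma to_eqv_in: "R \<in> EqL \<Omega> \<Longrightarrow> to_eqv R \<in> eqv_on \<Omega>"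
  using EqL_subset[of R] by (simp add: eqv_on_def eqv_rel_to_eqv) blast

lemma of_eqv_in: "of_eqv \<Omega> x \<in> EqL \<Omega>"
  unfolding EqL_iff
proof (rule equivI)
  show "of_eqv \<Omega> x \<subseteq> \<Omega> \<times> \<Omega>" by (auto simp: of_eqv_def)
  show "refl_on \<Omega> (of_eqv \<Omega> x)"
    using Id_subset_eqv_rel[of x] by (auto simp: of_eqv_def refl_on_def)
  show "sym (of_eqv \<Omega> x)"
    by (rule symI) (auto simp: of_eqv_def intro: symD[OF eqv_rel_props(2)])
  show "trans (of_eqv \<Omega> x)"
    by (rule transI) (auto simp: of_eqv_def intro: transD[OF eqv_rel_props(3)])
qed

lemma of_to_eqv: "R \<in> EqL \<Omega> \<Longrightarrow> of_eqv \<Omega> (to_eqv R) = R"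
  using EqL_subset[of R] by (simp add: of_eqv_def eqv_rel_to_eqv) blast

lemma to_of_eqv: "x \<in> eqv_on \<Omega> \<Longrightarrow> to_eqv (of_eqv \<Omega> x) = x"
proof -
  assume x: "x \<in> eqv_on \<Omega>"
  have "eqv_rel (to_eqv (of_eqv \<Omega> x)) = eqv_rel x"
    unfolding eqv_rel_to_eqv[OF of_eqv_in] using x eqv_rel_props(1)[of x]
    by (auto simp: of_eqv_def eqv_on_def refl_on_def)
  then show ?thesis by (simp add: eqv_rel_inject)
qed

lemma to_eqv_meet: "R \<in> EqL \<Omega> \<Longrightarrow> S \<in> EqL \<Omega> \<Longrightarrow> to_eqv (eq_meet R S) = inf (to_eqv R) (to_eqv S)"
  by (subst eqv_rel_inject[symmetric])
    (auto simp: eqv_rel_inf eqv_rel_to_eqv eq_meet_EqL, auto simp: eq_meet_def)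

lemma to_eqv_join:
  assumes "R \<in> EqL \<Omega>" "S \<in> EqL \<Omega>"
  shows "to_eqv (eq_join R S) = sup (to_eqv R) (to_eqv S)"
proof -
  have "((R \<union> Id) \<union> (S \<union> Id))\<^sup>+ = (R \<union> S)\<^sup>+ \<union> Id"
  proof
    have "trans ((R \<union> S)\<^sup>+ \<union> Id)" by (auto simp: trans_def)
    moreover have "(R \<union> Id) \<union> (S \<union> Id) \<subseteq> (R \<union> S)\<^sup>+ \<union> Id" by auto
    ultimately show "((R \<union> Id) \<union> (S \<union> Id))\<^sup>+ \<subseteq> (R \<union> S)\<^sup>+ \<union> Id"
      by (metis trancl_id trancl_mono_subset)
    have "(R \<union> S)\<^sup>+ \<subseteq> ((R \<union> Id) \<union> (S \<union> Id))\<^sup>+" by (intro trancl_mono_subset) auto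
    moreover have "Id \<subseteq> ((R \<union> Id) \<union> (S \<union> Id))\<^sup>+" by (auto intro: r_into_trancl)
    ultimately show "(R \<union> S)\<^sup>+ \<union> Id \<subseteq> ((R \<union> Id) \<union> (S \<union> Id))\<^sup>+" by (rule Un_least)
  qed
  then show ?thesis using assms
    by (subst eqv_rel_inject[symmetric]) (simp add: eqv_rel_sup eqv_rel_to_eqv eq_join_EqL, simp add: eq_join_def)
qed

lemma to_eqv_Id: "to_eqv (Id_on \<Omega>) = bot"
  unfolding to_eqv_def bot_eqv_def by (rule arg_cong[of _ _ Eqv]) auto

lemma of_eqv_meet: "x \<in> eqv_on \<Omega> \<Longrightarrow> y \<in> eqv_on \<Omega> \<Longrightarrow> of_eqv \<Omega> (inf x y) = eq_meet (of_eqv \<Omega> x) (of_eqv \<Omega> y)"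
  using to_eqv_meet[OF of_eqv_in of_eqv_in, of x y] of_to_eqv[OF eq_meet_EqL[OF of_eqv_in of_eqv_in], of x y]
  by (simp add: to_of_eqv)

lemma of_eqv_join: "x \<in> eqv_on \<Omega> \<Longrightarrow> y \<in> eqv_on \<Omega> \<Longrightarrow> of_eqv \<Omega> (sup x y) = eq_join (of_eqv \<Omega> x) (of_eqv \<Omega> y)"
  using to_eqv_join[OF of_eqv_in of_eqv_in, of x y] of_to_eqv[OF eq_join_EqL[OF of_eqv_in of_eqv_in], of x y]
  by (simp add: to_of_eqv)

end

lemma map_to_of_eqv:
  "wf_term I (EqL \<Omega>) p \<Longrightarrow> map_lterm id (of_eqv \<Omega>) (map_lterm id to_eqv p) = p"
  by (induction p) (auto simp: of_to_eqv)

lemma wf_map_to_eqv: "wf_term I (EqL \<Omega>) p \<Longrightarrow> wf_term I (eqv_on \<Omega>) (map_lterm id to_eqv p)"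
  by (induction p) (auto simp: to_eqv_in)

lemma cop_rel_to_eqv_iff:
  assumes "wf_term I (EqL \<Omega>) p" "wf_term I (EqL \<Omega>) q" "Z \<subseteq> EqL \<Omega>"
  shows "cop_rel I (eqv_on \<Omega>) inf sup (to_eqv ` Z) (map_lterm id to_eqv p) (map_lterm id to_eqv q) \<longleftrightarrow>
    cop_rel I (EqL \<Omega>) eq_meet eq_join Z p q"
proof
  assume c: "cop_rel I (eqv_on \<Omega>) inf sup (to_eqv ` Z) (map_lterm id to_eqv p) (map_lterm id to_eqv q)"
  have "cop_rel I (EqL \<Omega>) eq_meet eq_join Z
    (map_lterm id (of_eqv \<Omega>) (map_lterm id to_eqv p)) (map_lterm id (of_eqv \<Omega>) (map_lterm id to_eqv q))"
    by (rule cop_rel_map[OF c]) (use assms(3) in \<open>auto simp: of_eqv_in of_eqv_meet of_eqv_join of_to_eqv\<close>)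
  then show "cop_rel I (EqL \<Omega>) eq_meet eq_join Z p q" using assms by (simp add: map_to_of_eqv)
next
  assume c: "cop_rel I (EqL \<Omega>) eq_meet eq_join Z p q"
  show "cop_rel I (eqv_on \<Omega>) inf sup (to_eqv ` Z) (map_lterm id to_eqv p) (map_lterm id to_eqv q)"
    by (rule cop_rel_map[OF c]) (auto simp: to_eqv_in to_eqv_meet to_eqv_join)
qed

lemma cop_rel_Some_iff:
  fixes A :: "'b::lattice set"
  shows "cop_rel I (insert None (Some ` A)) inf sup {bot} (map_lterm id Some p) (map_lterm id Some q) \<longleftrightarrow>
    cop_rel I A inf sup {} p q"
proof
  assume "cop_rel I (insert None (Some ` A)) inf sup {bot} (map_lterm id Some p) (map_lterm id Some q)"
  from cop_rel_strip[OF this] show "cop_rel I A inf sup {} p q" by (simp add: strip_map_Some)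
next
  assume c: "cop_rel I A inf sup {} p q"
  show "cop_rel I (insert None (Some ` A)) inf sup {bot} (map_lterm id Some p) (map_lterm id Some q)"
    by (rule cop_rel_map[OF c]) auto
qed

section \<open>Valuations of terms in Eq \<Omega> and the four embeddings\<close>

lemma Id_on_EqL: "Id_on \<Omega> \<in> EqL \<Omega>"
  by (auto simp: EqL_iff equiv_def refl_on_def sym_def trans_def)

text \<open>Two such valuations yield all four statements: h induces an embedding of the coproduct,
  and h after \<open>dual\<close> one for the dual lattices.\<close>

locale Eq_valuation =
  fixes \<Omega> :: "'a set" and Z :: "('a \<times> 'a) set set"
    and h :: "('a set, ('a \<times> 'a) set) lterm \<Rightarrow> ('a \<times> 'a) set"
  assumes in_EqL: "wf_term (Pow \<Omega>) (EqL \<Omega>) p \<Longrightarrow> h p \<in> EqL \<Omega>"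
    and join: "wf_term (Pow \<Omega>) (EqL \<Omega>) p \<Longrightarrow> wf_term (Pow \<Omega>) (EqL \<Omega>) q \<Longrightarrow>
      h (TJoin p q) = eq_join (h p) (h q)"
    and meet: "wf_term (Pow \<Omega>) (EqL \<Omega>) p \<Longrightarrow> wf_term (Pow \<Omega>) (EqL \<Omega>) q \<Longrightarrow>
      h (TMeet p q) = eq_meet (h p) (h q)"
    and eq_iff: "wf_term (Pow \<Omega>) (EqL \<Omega>) p \<Longrightarrow> wf_term (Pow \<Omega>) (EqL \<Omega>) q \<Longrightarrow>
      h p = h q \<longleftrightarrow> cop_rel (Pow \<Omega>) (EqL \<Omega>) eq_meet eq_join Z p q"
begin

lemma embedding:
  "cop_embedding (Pow \<Omega>) (EqL \<Omega>) eq_meet eq_join Z (EqL \<Omega>) eq_meet eq_join (on_classes h)"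
  by (rule cop_embedding_on_classes)
    (simp_all add: in_EqL join meet eq_iff eq_meet_EqL eq_join_EqL)

lemma embedding_dual:
  "cop_embedding (Pow \<Omega>) (EqL \<Omega>) eq_join eq_meet Z (EqL \<Omega>) eq_join eq_meet (on_classes (h \<circ> dual))"
  by (rule cop_embedding_on_classes)
    (simp_all add: in_EqL join meet eq_iff eq_meet_EqL eq_join_EqL wf_dual cop_rel_dual_iff)

lemma value_Gen:
  assumes "i \<in> Pow \<Omega>" "x \<in> EqL \<Omega>"
  shows "on_classes h (cop_class (Pow \<Omega>) (EqL \<Omega>) eq_meet eq_join Z (Gen i x)) = h (Gen i x)"
    and "on_classes (h \<circ> dual) (cop_class (Pow \<Omega>) (EqL \<Omega>) eq_join eq_meet Z (Gen i x)) = h (Gen i x)"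
proof -
  show "on_classes h (cop_class (Pow \<Omega>) (EqL \<Omega>) eq_meet eq_join Z (Gen i x)) = h (Gen i x)"
    by (rule on_classes) (use assms in \<open>simp_all add: eq_iff eq_meet_EqL eq_join_EqL\<close>)
  have "on_classes (h \<circ> dual) (cop_class (Pow \<Omega>) (EqL \<Omega>) eq_join eq_meet Z (Gen i x)) = (h \<circ> dual) (Gen i x)"
    by (rule on_classes)
      (use assms in \<open>simp_all add: eq_iff eq_meet_EqL eq_join_EqL wf_dual cop_rel_dual_iff\<close>)
  then show "on_classes (h \<circ> dual) (cop_class (Pow \<Omega>) (EqL \<Omega>) eq_join eq_meet Z (Gen i x)) = h (Gen i x)"
    by simp
qed

end

lemma Eq_valuation_zero:
  fixes \<Omega> :: "'a set"
  assumes "infinite \<Omega>"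
  obtains h where "Eq_valuation \<Omega> {Id_on \<Omega>} h" "\<And>i. i \<in> Pow \<Omega> \<Longrightarrow> h (Gen i (Id_on \<Omega>)) = Id_on \<Omega>"
proof -
  interpret dense_sublattice "eqv_on \<Omega>" "fin_eqv_on \<Omega>" by (rule dense_sublattice_eqv)
  obtain h :: "('a set, 'a eqv) lterm \<Rightarrow> ('a \<times> 'a) set"
    where h: "\<And>p. wf_term (Pow \<Omega>) (eqv_on \<Omega>) p \<Longrightarrow> equiv \<Omega> (h p)"
    "\<And>p q. wf_term (Pow \<Omega>) (eqv_on \<Omega>) p \<Longrightarrow> wf_term (Pow \<Omega>) (eqv_on \<Omega>) q \<Longrightarrow>
      h (TJoin p q) = (h p \<union> h q)\<^sup>+"
    "\<And>p q. wf_term (Pow \<Omega>) (eqv_on \<Omega>) p \<Longrightarrow> wf_term (Pow \<Omega>) (eqv_on \<Omega>) q \<Longrightarrow>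
      h (TMeet p q) = h p \<inter> h q"
    "\<And>p q. wf_term (Pow \<Omega>) (eqv_on \<Omega>) p \<Longrightarrow> wf_term (Pow \<Omega>) (eqv_on \<Omega>) q \<Longrightarrow>
      h p = h q \<longleftrightarrow> cop_rel (Pow \<Omega>) (eqv_on \<Omega>) inf sup {bot} p q"
    "\<And>i. i \<in> Pow \<Omega> \<Longrightarrow> h (Gen i bot) = Id_on \<Omega>"
    by (rule coproduct_in_Eq[OF assms fin_eqv_on_lepoll[OF assms]]) (rule that)
  let ?h = "h \<circ> map_lterm id to_eqv"
  have "Eq_valuation \<Omega> {Id_on \<Omega>} ?h"
  proof
    fix p q :: "('a set, ('a \<times> 'a) set) lterm"
    assume wf: "wf_term (Pow \<Omega>) (EqL \<Omega>) p"
    note p = wf_map_to_eqv[OF wf]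
    show "?h p \<in> EqL \<Omega>" using h(1)[OF p] by (simp add: EqL_iff)
    assume wf': "wf_term (Pow \<Omega>) (EqL \<Omega>) q"
    note q = wf_map_to_eqv[OF wf']
    show "?h (TJoin p q) =
        eq_join (?h p) (?h q)"
      using h(2)[OF p q] by (simp add: eq_join_def)
    show "?h (TMeet p q) =
        eq_meet (?h p) (?h q)"
      using h(3)[OF p q] by (simp add: eq_meet_def)
    show "?h p = ?h q \<longleftrightarrow>
        cop_rel (Pow \<Omega>) (EqL \<Omega>) eq_meet eq_join {Id_on \<Omega>} p q"
      using h(4)[OF p q] cop_rel_to_eqv_iff[OF wf wf', of "{Id_on \<Omega>}"] by (simp add: Id_on_EqL to_eqv_Id)
  qed
  then show ?thesis by (rule that) (simp add: to_eqv_Id h)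
qed

lemma Eq_valuation_free:
  fixes \<Omega> :: "'a set"
  assumes "infinite \<Omega>"
  obtains h where "Eq_valuation \<Omega> {} h"
proof -
  let ?A = "insert None (Some ` eqv_on \<Omega>)" and ?K = "insert None (Some ` fin_eqv_on \<Omega>)"
  interpret dense_sublattice ?A ?K by (intro dense_sublattice_option dense_sublattice_eqv)
  have "Some ` fin_eqv_on \<Omega> \<lesssim> \<Omega>"
    using image_lepoll fin_eqv_on_lepoll[OF assms] by (rule lepoll_trans)
  then have K: "?K \<lesssim> \<Omega>"
    using assms by (meson infinite_insert_lepoll insert_lepoll_cong lepoll_trans finite_insert finite_lepoll_infinite)
  obtain h :: "('a set, 'a eqv option) lterm \<Rightarrow> ('a \<times> 'a) set"
    where h: "\<And>p. wf_term (Pow \<Omega>) ?A p \<Longrightarrow> equiv \<Omega> (h p)"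
    "\<And>p q. wf_term (Pow \<Omega>) ?A p \<Longrightarrow> wf_term (Pow \<Omega>) ?A q \<Longrightarrow> h (TJoin p q) = (h p \<union> h q)\<^sup>+"
    "\<And>p q. wf_term (Pow \<Omega>) ?A p \<Longrightarrow> wf_term (Pow \<Omega>) ?A q \<Longrightarrow> h (TMeet p q) = h p \<inter> h q"
    "\<And>p q. wf_term (Pow \<Omega>) ?A p \<Longrightarrow> wf_term (Pow \<Omega>) ?A q \<Longrightarrow>
      h p = h q \<longleftrightarrow> cop_rel (Pow \<Omega>) ?A inf sup {bot} p q"
    by (rule coproduct_in_Eq[OF assms K]) (rule that)
  have wf_Some: "wf_term I ?A (map_lterm id Some p)" if "wf_term I (eqv_on \<Omega>) p" for I and p :: "('i, 'a eqv) lterm"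
    using that by (induction p) auto
  let ?h = "h \<circ> map_lterm id Some \<circ> map_lterm id to_eqv"
  have "Eq_valuation \<Omega> {} ?h"
  proof
    fix p q :: "('a set, ('a \<times> 'a) set) lterm"
    assume wf: "wf_term (Pow \<Omega>) (EqL \<Omega>) p"
    note p = wf_Some[OF wf_map_to_eqv[OF wf]]
    show "?h p \<in> EqL \<Omega>" using h(1)[OF p] by (simp add: EqL_iff)
    assume wf': "wf_term (Pow \<Omega>) (EqL \<Omega>) q"
    note q = wf_Some[OF wf_map_to_eqv[OF wf']]
    show "?h (TJoin p q) = eq_join (?h p) (?h q)" using h(2)[OF p q] by (simp add: eq_join_def)
    show "?h (TMeet p q) = eq_meet (?h p) (?h q)" using h(3)[OF p q] by (simp add: eq_meet_def)
    show "?h p = ?h q \<longleftrightarrow> cop_rel (Pow \<Omega>) (EqL \<Omega>) eq_meet eq_join {} p q"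
      using h(4)[OF p q] cop_rel_to_eqv_iff[OF wf wf', of "{}"] by (simp add: cop_rel_Some_iff)
  qed
  then show ?thesis by (rule that)
qed

theorem theorem6p6:
  fixes \<Omega> :: "'a set"
  assumes "infinite \<Omega>"
  shows
    "(\<exists>h. cop_embedding (Pow \<Omega>) (EqL \<Omega>) eq_meet eq_join {Id_on \<Omega>}
              (EqL \<Omega>) eq_meet eq_join h \<and>
          (\<forall>i\<in>Pow \<Omega>. h (cop_class (Pow \<Omega>) (EqL \<Omega>) eq_meet eq_join {Id_on \<Omega>}
                                (Gen i (Id_on \<Omega>))) = Id_on \<Omega>))
   \<and> (\<exists>h. cop_embedding (Pow \<Omega>) (EqL \<Omega>) eq_meet eq_join {}
              (EqL \<Omega>) eq_meet eq_join h)
   \<and> (\<exists>h. cop_embedding (Pow \<Omega>) (EqL \<Omega>) eq_join eq_meet {Id_on \<Omega>}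
              (EqL \<Omega>) eq_join eq_meet h \<and>
          (\<forall>i\<in>Pow \<Omega>. h (cop_class (Pow \<Omega>) (EqL \<Omega>) eq_join eq_meet {Id_on \<Omega>}
                                (Gen i (Id_on \<Omega>))) = Id_on \<Omega>))
   \<and> (\<exists>h. cop_embedding (Pow \<Omega>) (EqL \<Omega>) eq_join eq_meet {}
              (EqL \<Omega>) eq_join eq_meet h)"
proof -
  obtain h0 where h0: "Eq_valuation \<Omega> {Id_on \<Omega>} h0" "\<And>i. i \<in> Pow \<Omega> \<Longrightarrow> h0 (Gen i (Id_on \<Omega>)) = Id_on \<Omega>"
    using Eq_valuation_zero[OF assms] by blast
  obtain h where h: "Eq_valuation \<Omega> {} h" using Eq_valuation_free[OF assms] by blast
  note Gen = Eq_valuation.value_Gen[OF h0(1) _ Id_on_EqL]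
  show ?thesis
    by (intro conjI exI[of _ "on_classes h0"] exI[of _ "on_classes h"] exI[of _ "on_classes (h0 \<circ> dual)"]
        exI[of _ "on_classes (h \<circ> dual)"] Eq_valuation.embedding Eq_valuation.embedding_dual h0(1) h ballI)
      (simp_all only: Gen h0(2))
qed

end
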